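(* If $u$ and $v$ are two non-constant inner functions belonging to $\mathfrak I_c$, then the composition $u\circ v$ belongs to $\mathfrak I_c$.
   Context: $\mathbb D$ is the open unit disk in $\mathbb C$, and $H^\infty$ is the algebra of bounded holomorphic functions on $\mathbb D$. An inner function is a function $u\in H^\infty$ whose radial limits have modulus $1$ almost everywhere on the unit circle $\mathbb T$. For an inner function $u$ and $\eta\in\,]0,1[$ put $\Omega_u(\eta):=\{z\in\mathbb D: |u(z)|<\eta\}$. An inner function $u$ is called a one-component inner function if there is $\eta\in\,]0,1[$ such that $\Omega_u(\eta)$ is connected; unimodular constants are considered to be one-component inner functions. $\mathfrak I_c$ denotes the set of all one-component inner functions. *)

theory Defs
  imports "HOL-Complex_Analysis.Complex_Analysis"
begin

text \<open>
  Functions on the open unit disk \<open>ball 0 1\<close> are represented by total functions on the complex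
  plane; only their values on the disk are relevant.
\<close>

definition H_infinity :: "(complex \<Rightarrow> complex) set" where
  "H_infinity = {f. f holomorphic_on ball 0 1 \<and> bounded (f ` ball 0 1)}"

definition has_radial_limit :: "(complex \<Rightarrow> complex) \<Rightarrow> complex \<Rightarrow> complex \<Rightarrow> bool" where
  "has_radial_limit f l \<zeta> \<longleftrightarrow> ((\<lambda>r::real. f (of_real r * \<zeta>)) \<longlongrightarrow> l) (at_left 1)"

text \<open>
  Arc length on the unit circle is Lebesgue measure of the angle. The existence of the radial limit
  almost everywhere, which is automatic for bounded holomorphic functions by Fatou's theorem, is
  part of the condition here.
\<close>

definition inner_function :: "(complex \<Rightarrow> complex) \<Rightarrow> bool" where
  "inner_function u \<longleftrightarrow> u \<in> H_infinity \<and>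
     (AE t in lebesgue_on {0..2 * pi}. \<exists>l. has_radial_limit u l (cis t) \<and> norm l = 1)"

definition sublevel_set :: "(complex \<Rightarrow> complex) \<Rightarrow> real \<Rightarrow> complex set" where
  "sublevel_set u \<eta> = {z \<in> ball 0 1. norm (u z) < \<eta>}"

text \<open>A constant inner function is necessarily a unimodular constant.\<close>

definition one_component_inner :: "(complex \<Rightarrow> complex) set" where
  "one_component_inner = {u. inner_function u \<and>
     (u constant_on ball 0 1 \<or> (\<exists>\<eta>\<in>{0<..<1}. connected (sublevel_set u \<eta>)))}"

end

theory Submission
  imports Defs
begin

text \<open>
  Connectedness: for an inner function \<open>v\<close> and a connected open \<open>D\<close>, every component of the
  preimage of \<open>D\<close> has dense image in \<open>D\<close>, because otherwise \<open>1 / (v - w)\<close> violates a maximum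
  principle in which the part of the boundary on the circle is negligible. So the preimage of \<open>D\<close>
  is connected as soon as the preimage of some nonempty open subset of \<open>D\<close> is. Apply this to \<open>u\<close>
  and a disk of large radius \<open>\<eta>'\<close>, then to \<open>v\<close> and the sublevel set of \<open>u\<close> at height \<open>\<eta>'\<close>,
  which contains a disk whose preimage under \<open>v\<close> is connected.

  The composition is inner: the dilates \<open>u (r * v z)\<close> have radial limits almost everywhere, of
  modulus close to \<open>1\<close> off a small set since \<open>v\<close> pulls back small sets of the circle to small
  sets. The weak type estimate for the radial maximal function and Littlewood subordination show
  that they approximate \<open>u (v z)\<close> uniformly along all radii off a small set.
\<close>

subsection \<open>The Poisson formula on circles\<close>

definition poisson_kernel :: "complex \<Rightarrow> complex \<Rightarrow> real" where
  "poisson_kernel z w = ((norm w)\<^sup>2 - (norm z)\<^sup>2) / (norm (w - z))\<^sup>2"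

lemma poisson_kernel_nonneg: "norm z \<le> norm w \<Longrightarrow> 0 \<le> poisson_kernel z w"
  by (simp add: poisson_kernel_def power_mono)

lemma poisson_kernel_le:
  assumes "norm z < norm w"
  shows "poisson_kernel z w \<le> (norm w + norm z) / (norm w - norm z)"
proof -
  have d: "0 < norm w - norm z" "norm w - norm z \<le> norm (w - z)"
    using assms norm_triangle_ineq2[of w z] by auto
  have "poisson_kernel z w \<le> ((norm w)\<^sup>2 - (norm z)\<^sup>2) / (norm w - norm z)\<^sup>2"
    unfolding poisson_kernel_def
    using d assms by (intro divide_left_mono power_mono mult_pos_pos) (auto simp: power_mono)
  also have "\<dots> = ((norm w - norm z) * (norm w + norm z)) / ((norm w - norm z) * (norm w - norm z))"
    by (simp add: algebra_simps power2_eq_square)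
  also have "\<dots> = (norm w + norm z) / (norm w - norm z)"
    using d by simp
  finally show ?thesis .
qed

lemma poisson_kernel_Re: "poisson_kernel z w = Re ((w + z) / (w - z))"
proof -
  have "Re ((w + z) / (w - z)) = (Re (w + z) * Re (w - z) + Im (w + z) * Im (w - z)) / (norm (w - z))\<^sup>2"
    by (simp only: Re_divide cmod_power2)
  also have "Re (w + z) * Re (w - z) + Im (w + z) * Im (w - z) = (norm w)\<^sup>2 - (norm z)\<^sup>2"
    unfolding cmod_power2 by (simp add: algebra_simps power2_eq_square)
  finally show ?thesis by (simp add: poisson_kernel_def)
qed

lemma Poisson_formula:
  assumes hol: "g holomorphic_on cball 0 R" and z: "norm z < R"
  shows "((\<lambda>t. of_real (poisson_kernel z (of_real R * cis t)) * g (of_real R * cis t))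
           has_integral (of_real (2 * pi) * g z)) {0..2 * pi}"
proof -
  have R: "R > 0" using z norm_ge_zero[of z] by linarith
  define f where "f w = g w * (of_real (R\<^sup>2 - (norm z)\<^sup>2) / (of_real (R\<^sup>2) - cnj z * w))" for w
  have nz: "of_real (R\<^sup>2) - cnj z * w \<noteq> 0" if "w \<in> cball 0 R" for w
  proof
    assume "of_real (R\<^sup>2) - cnj z * w = 0"
    then have "cnj z * w = of_real (R\<^sup>2)" by simp
    then have "norm (cnj z * w) = R\<^sup>2" by (metis norm_of_real abs_power2 power2_abs abs_of_nonneg zero_le_power2)
    then have "norm z * norm w = R * R" by (simp add: norm_mult power2_eq_square)
    moreover have "norm z * norm w \<le> norm z * R" using that by (intro mult_left_mono) auto
    moreover have "norm z * R < R * R" using z R by simp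
    ultimately show False by linarith
  qed
  have "f holomorphic_on cball 0 R"
    unfolding f_def using nz by (intro holomorphic_intros hol) auto
  then have "((\<lambda>u. f u / (u - z)) has_contour_integral (2 * of_real pi * \<i> * f z)) (circlepath 0 R)"
    using z by (intro Cauchy_integral_circlepath_simple) auto
  then have I: "((\<lambda>t. f (0 + of_real R * cis t) / (0 + of_real R * cis t - z) * of_real R * \<i> * cis t) has_integral
       (2 * of_real pi * \<i> * f z)) {0..2*pi}"
    unfolding circlepath_def using has_contour_integral_part_circlepath_iff[of 0 "2*pi"] by simp
  have fz: "f z = g z"
  proof -
    have "of_real (R\<^sup>2) - cnj z * z = of_real (R\<^sup>2 - (norm z)\<^sup>2)"
      by (metis complex_norm_square mult.commute of_real_diff)
    then show ?thesis using nz[of z] z unfolding f_def by auto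
  qed
  have eq: "- \<i> * (f (0 + of_real R * cis t) / (0 + of_real R * cis t - z) * of_real R * \<i> * cis t)
     = of_real (poisson_kernel z (of_real R * cis t)) * g (of_real R * cis t)" for t
  proof -
    define w where "w = of_real R * cis t"
    have nw: "norm w = R" using R by (simp add: w_def norm_mult)
    then have w0: "w \<noteq> 0" and wz: "w - z \<noteq> 0" using R z by auto
    have cz: "cnj w - cnj z \<noteq> 0" using wz by (metis complex_cnj_diff complex_cnj_zero_iff)
    have R2: "of_real (R\<^sup>2) - cnj z * w = w * (cnj w - cnj z)"
      using nw complex_norm_square[of w] by (simp add: algebra_simps)
    have N: "of_real ((norm (w - z))\<^sup>2) = (w - z) * (cnj w - cnj z)"
      using complex_norm_square[of "w - z"] by simp
    have "- \<i> * (f w / (w - z) * w * \<i>) = (- \<i> * \<i>) * (f w * w / (w - z))" by (simp only: mult_ac times_divide_eq_right times_divide_eq_left mult_minus_left mult_minus_right)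
    also have "\<dots> = f w * w / (w - z)" by simp
    also have "\<dots> = g w * of_real (R\<^sup>2 - (norm z)\<^sup>2) / ((w - z) * (cnj w - cnj z))"
    proof -
      have *: "x * (a / (b * c)) * b / d = x * a / (d * c)" if "b \<noteq> 0" for a b c d x :: complex
        using that by simp
      show ?thesis unfolding f_def R2 by (rule *[OF w0])
    qed
    also have "\<dots> = of_real (poisson_kernel z w) * g w"
      unfolding poisson_kernel_def of_real_divide N nw by simp
    finally show ?thesis by (simp add: w_def mult_ac)
  qed
  show ?thesis
    using has_integral_mult_right[OF I, of "- \<i>"] unfolding eq fz by (simp add: mult_ac)
qed

lemma continuous_on_circle:
  fixes g :: "complex \<Rightarrow> 'a::topological_space"
  assumes "continuous_on (sphere 0 R) g" "R \<ge> 0"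
  shows "continuous_on A (\<lambda>t. g (of_real R * cis t))"
  by (rule continuous_on_compose2[OF assms(1)]) (use assms(2) in \<open>auto intro!: continuous_intros simp: norm_mult\<close>)

lemma continuous_on_poisson_kernel:
  assumes "norm z < R"
  shows "continuous_on A (\<lambda>t. poisson_kernel z (of_real R * cis t))"
proof -
  have R: "R > 0" using assms norm_ge_zero[of z] by linarith
  have "of_real R * cis t \<noteq> z" for t
    using assms R by (auto simp: norm_mult)
  then show ?thesis
    unfolding poisson_kernel_def by (intro continuous_intros) auto
qed

lemma Poisson_kernel_integral:
  assumes "norm z < R"
  shows "((\<lambda>t. poisson_kernel z (of_real R * cis t)) has_integral (2 * pi)) {0..2 * pi}"
  using has_integral_Re[OF Poisson_formula[of "\<lambda>_. 1", OF _ assms]] by simp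

lemma Poisson_inequality:
  assumes hol: "g holomorphic_on cball 0 R" and z: "norm z < R"
  shows "2 * pi * norm (g z) \<le> integral {0..2 * pi}
           (\<lambda>t. poisson_kernel z (of_real R * cis t) * norm (g (of_real R * cis t)))"
proof -
  have R: "R > 0" using z norm_ge_zero[of z] by linarith
  have cg: "continuous_on (sphere 0 R) g"
    using holomorphic_on_imp_continuous_on[OF hol] continuous_on_subset by fastforce
  have cont: "continuous_on {0..2*pi} (\<lambda>t. g (of_real R * cis t))"
      "continuous_on {0..2*pi} (\<lambda>t. poisson_kernel z (of_real R * cis t))"
    using continuous_on_circle[OF cg] continuous_on_poisson_kernel[OF z] R by auto
  have "norm (of_real (2 * pi) * g z)
      = norm (integral {0..2*pi} (\<lambda>t. of_real (poisson_kernel z (of_real R * cis t)) * g (of_real R * cis t)))"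
    using Poisson_formula[OF assms] by (simp add: integral_unique)
  also have "\<dots> \<le> integral {0..2 * pi}
           (\<lambda>t. poisson_kernel z (of_real R * cis t) * norm (g (of_real R * cis t)))"
    using z R
    by (intro Henstock_Kurzweil_Integration.integral_norm_bound_integral integrable_continuous_real continuous_intros cont)
       (auto simp: norm_mult abs_of_nonneg poisson_kernel_nonneg)
  finally show ?thesis by (simp add: norm_mult)
qed

lemma circle_mean:
  assumes hol: "g holomorphic_on cball 0 R" and R: "0 < R"
  shows "((\<lambda>t. g (of_real R * cis t)) has_integral (of_real (2 * pi) * g 0)) {0..2 * pi}"
proof -
  have "poisson_kernel 0 (of_real R * cis t) = 1" for t
    using R by (simp add: poisson_kernel_def norm_mult)
  then show ?thesis
    using Poisson_formula[OF hol, of 0] R by simp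
qed

subsection \<open>Maximal functions\<close>

lemma integral_periodic:
  fixes f :: "real \<Rightarrow> real"
  assumes cont: "continuous_on UNIV f" and per: "\<And>x. f (x + p) = f x"
    and p: "0 < p" and a: "- p \<le> a" "a \<le> p"
  shows "integral {a..a + p} f = integral {0..p} f"
proof -
  have int: "f integrable_on {c..d}" for c d
    by (intro integrable_continuous_real continuous_on_subset[OF cont]) auto
  have shift: "integral {c..d} f = integral {c + p..d + p} f" for c d
    using integral_shift_real_ivl[of "c + p" p "d + p" f] per by simp
  have comb: "integral {c..e} f = integral {c..d} f + integral {d..e} f" if "c \<le> d" "d \<le> e" for c d e
    using Henstock_Kurzweil_Integration.integral_combine[OF that int] by simp
  show ?thesis
  proof (cases "a \<le> 0")
    case True
    then show ?thesis
      using comb[of a 0 "a + p"] comb[of 0 "a + p" p] shift[of a 0] a p by simp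
  next
    case False
    then show ?thesis
      using comb[of a p "a + p"] comb[of 0 a p] shift[of 0 a] a p by (simp add: add.commute)
  qed
qed

lemma maximal_function_cover:
  fixes \<phi> :: "real \<Rightarrow> real"
  assumes cont: "continuous_on UNIV \<phi>" and nonneg: "\<And>x. 0 \<le> \<phi> x" and c: "0 < c"
  obtains T where "T \<in> lmeasurable" "measure lebesgue T \<le> 5 / c * integral {a - p..b + p} \<phi>"
    "\<And>t h. \<lbrakk>t \<in> {a..b}; t \<notin> T; 0 < h; h \<le> p\<rbrakk> \<Longrightarrow> integral {t - h..t + h} \<phi> \<le> 2 * h * c"
proof -
  have int: "\<phi> integrable_on {d..e}" for d e
    by (intro integrable_continuous_real continuous_on_subset[OF cont]) auto
  define K where "K = {(t, h). t \<in> {a..b} \<and> 0 < h \<and> h \<le> p \<and> 2 * h * c < integral {t - h..t + h} \<phi>}"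
  define S where "S = (\<Union>i\<in>K. cball (fst i) (snd i))"
  have "S \<subseteq> (\<Union>i\<in>K. cball (fst i) (snd i))" by (simp add: S_def)
  moreover have "0 < snd i \<and> snd i \<le> p" if "i \<in> K" for i using that by (auto simp: K_def)
  ultimately obtain C where C: "countable C" "C \<subseteq> K"
     "pairwise (\<lambda>i j. disjnt (cball (fst i) (snd i)) (cball (fst j) (snd j))) C"
     "S \<subseteq> (\<Union>i\<in>C. cball (fst i) (5 * snd i))"
    by (rule Vitali_covering_lemma_cballs)
  define A where "A i = cball (fst i) (5 * snd i)" for i :: "real \<times> real"
  define B where "B = 5 / c * integral {a - p..b + p} \<phi>"
  have A: "A i \<in> lmeasurable" for i by (simp add: A_def)
  have bound: "measure lebesgue (\<Union>i\<in>I. A i) \<le> B" if I: "I \<subseteq> C" "finite I" for I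
  proof -
    have IK: "i \<in> K" if "i \<in> I" for i using I C that by auto
    have hi: "(\<phi> has_integral (\<Sum>i\<in>I. integral (cball (fst i) (snd i)) \<phi>)) (\<Union>i\<in>I. cball (fst i) (snd i))"
    proof (rule has_integral_UN)
      show "pairwise (\<lambda>i i'. negligible (cball (fst i) (snd i) \<inter> cball (fst i') (snd i'))) I"
        using pairwise_subset[OF C(3) I(1)] by (auto simp: pairwise_def disjnt_def)
    qed (use I int in \<open>auto simp: cball_eq_atLeastAtMost intro!: integrable_integral\<close>)
    have "measure lebesgue (\<Union>i\<in>I. A i) \<le> (\<Sum>i\<in>I. measure lebesgue (A i))"
      by (rule measure_UNION_le) (use I A in auto)
    also have "\<dots> \<le> (\<Sum>i\<in>I. 5 / c * integral (cball (fst i) (snd i)) \<phi>)"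
    proof (rule sum_mono)
      fix i assume "i \<in> I"
      then have i: "0 < snd i" "2 * snd i * c < integral {fst i - snd i..fst i + snd i} \<phi>"
        using IK[of i] by (auto simp: K_def split_beta)
      have "measure lebesgue (A i) = 10 * snd i" using i by (simp add: A_def cball_eq_atLeastAtMost)
      also have "\<dots> \<le> 5 / c * integral {fst i - snd i..fst i + snd i} \<phi>"
        using i c by (simp add: field_simps)
      finally show "measure lebesgue (A i) \<le> 5 / c * integral (cball (fst i) (snd i)) \<phi>"
        by (simp add: cball_eq_atLeastAtMost)
    qed
    also have "\<dots> = 5 / c * (\<Sum>i\<in>I. integral (cball (fst i) (snd i)) \<phi>)"
      by (simp add: sum_distrib_left)
    also have "(\<Sum>i\<in>I. integral (cball (fst i) (snd i)) \<phi>) = integral (\<Union>i\<in>I. cball (fst i) (snd i)) \<phi>"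
      using hi by (simp add: integral_unique)
    also have "\<dots> \<le> integral {a - p..b + p} \<phi>"
    proof (rule integral_subset_le)
      show "(\<Union>i\<in>I. cball (fst i) (snd i)) \<subseteq> {a - p..b + p}"
        using IK by (fastforce simp: K_def cball_eq_atLeastAtMost split_beta)
    qed (use nonneg int hi in auto)
    finally show ?thesis using c by (simp add: B_def mult_left_mono divide_right_mono)
  qed
  show thesis
  proof
    show "(\<Union>i\<in>C. A i) \<in> lmeasurable" by (rule fmeasurable_UN_bound[OF C(1) A bound])
    show "measure lebesgue (\<Union>i\<in>C. A i) \<le> 5 / c * integral {a - p..b + p} \<phi>"
      using measure_UN_bound[OF C(1) A bound] unfolding B_def .
    fix t h assume t: "t \<in> {a..b}" "t \<notin> (\<Union>i\<in>C. A i)" "0 < h" "h \<le> p"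
    show "integral {t - h..t + h} \<phi> \<le> 2 * h * c"
    proof (rule ccontr)
      assume "\<not> ?thesis"
      then have "(t, h) \<in> K" using t by (auto simp: K_def)
      then have "t \<in> S" using t by (force simp: S_def)
      then show False using C(4) t(2) unfolding A_def by blast
    qed
  qed
qed

lemma eventually_in_sets_cover:
  fixes T :: "nat \<Rightarrow> 'a::euclidean_space set"
  assumes T: "\<And>k. T k \<in> lmeasurable" "\<And>k. measure lebesgue (T k) \<le> e"
  obtains U where "U \<in> lmeasurable" "measure lebesgue U \<le> e" "{x. \<forall>\<^sub>F k in sequentially. x \<in> T k} \<subseteq> U"
proof -
  define V where "V n = (\<Inter>k\<in>{n..}. T k)" for n
  have V: "V n \<in> lmeasurable" for n
    unfolding V_def by (intro fmeasurable_INT[of "{n..}" n]) (use T in \<open>auto\<close>)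
  have mV: "measure lebesgue (V n) \<le> e" for n
  proof -
    have "measure lebesgue (V n) \<le> measure lebesgue (T n)"
      by (rule measure_mono_fmeasurable) (use V T in \<open>auto simp: V_def\<close>)
    then show ?thesis using T(2)[of n] by linarith
  qed
  have nest: "V n \<subseteq> V (Suc n)" for n by (auto simp: V_def)
  have U: "(\<Union>n. V n) \<in> lmeasurable" by (rule measurable_nested_Union[of V, OF V mV nest])
  moreover have "measure lebesgue (\<Union>n. V n) \<le> e"
    using LIMSEQ_le_const2[OF measure_nested_Union[of V, OF V mV nest]] mV by blast
  moreover have "{x. \<forall>\<^sub>F k in sequentially. x \<in> T k} \<subseteq> (\<Union>n. V n)"
    by (auto simp: V_def eventually_sequentially)
  ultimately show thesis by (rule that)
qed

lemma poisson_kernel_rotate: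
  "poisson_kernel (of_real r * cis t) (of_real R * cis (t + s)) = (R\<^sup>2 - r\<^sup>2) / (R\<^sup>2 + r\<^sup>2 - 2 * R * r * cos s)"
proof -
  have "of_real R * cis (t + s) - of_real r * cis t = cis t * (of_real R * cis s - of_real r)"
    by (simp add: cis_mult[symmetric] algebra_simps)
  then have "(norm (of_real R * cis (t + s) - of_real r * cis t))\<^sup>2 = (norm (of_real R * cis s - of_real r))\<^sup>2"
    by (simp add: norm_mult)
  also have "\<dots> = (R * cos s - r)\<^sup>2 + (R * sin s)\<^sup>2"
    by (simp add: cmod_power2)
  also have "\<dots> = R\<^sup>2 * ((sin s)\<^sup>2 + (cos s)\<^sup>2) + r\<^sup>2 - 2 * R * r * cos s"
    by (simp add: power2_eq_square algebra_simps del: sin_cos_squared_add sin_cos_squared_add2 sin_cos_squared_add3)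
  finally show ?thesis
    by (simp add: poisson_kernel_def norm_mult power_mult_distrib)
qed

text \<open>A symmetrically decreasing kernel averages intervals centred at \<open>t\<close>, so it is controlled by
  the maximal function at \<open>t\<close>; this is integration by parts.\<close>
lemma decreasing_kernel_bound:
  fixes \<phi> K K' :: "real \<Rightarrow> real"
  assumes cont: "continuous_on UNIV \<phi>" and c: "\<And>h. \<lbrakk>0 < h; h \<le> p\<rbrakk> \<Longrightarrow> integral {t - h..t + h} \<phi> \<le> 2 * h * c"
    and p: "0 < p" and K: "\<And>h. h \<in> {0..p} \<Longrightarrow> 0 \<le> K h"
    and der: "\<And>h. (K has_real_derivative K' h) (at h)" and contK': "continuous_on UNIV K'"
    and K': "\<And>h. h \<in> {0..p} \<Longrightarrow> K' h \<le> 0"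
    and even: "\<And>h. K (- h) = K h"
  shows "integral {-p..p} (\<lambda>h. K h * \<phi> (t + h)) \<le> c * integral {-p..p} K"
proof -
  have contK: "continuous_on UNIV K"
    by (intro continuous_at_imp_continuous_on ballI DERIV_isCont[OF der])
  define F where "F x = integral {t - 2 * p..x} \<phi>" for x
  have dF: "(F has_real_derivative \<phi> x) (at x)" if "x \<in> {t - 2 * p<..<t + 2 * p}" for x
  proof -
    have "(F has_real_derivative \<phi> x) (at x within {t - 2 * p..t + 2 * p})"
      unfolding F_def using that
      by (intro integral_has_real_derivative continuous_on_subset[OF cont]) auto
    then show ?thesis
      using that at_within_interior[of x "{t - 2 * p..t + 2 * p}"] by simp
  qed
  define W where "W h = F (t + h) - F (t - h) - 2 * c * h" for h
  have W: "W h \<le> 0" if h: "h \<in> {0..p}" for h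
  proof (cases "h = 0")
    case False
    have "F (t - h) + integral {t - h..t + h} \<phi> = F (t + h)"
      unfolding F_def using h p
      by (intro Henstock_Kurzweil_Integration.integral_combine integrable_continuous_real continuous_on_subset[OF cont]) auto
    then show ?thesis using c[of h] h False by (simp add: W_def mult_ac)
  qed (simp add: W_def)
  define W' where "W' h = \<phi> (t + h) + \<phi> (t - h) - 2 * c" for h
  have dW: "(W has_real_derivative W' h) (at h)" if "h \<in> {0..p}" for h
  proof -
    have "((\<lambda>h. F (t + h)) has_real_derivative \<phi> (t + h) * 1) (at h)"
      by (rule DERIV_chain2[OF dF]) (use that p in \<open>auto intro!: derivative_eq_intros\<close>)
    moreover have "((\<lambda>h. F (t - h)) has_real_derivative \<phi> (t - h) * (- 1)) (at h)"
      by (rule DERIV_chain2[OF dF]) (use that p in \<open>auto intro!: derivative_eq_intros\<close>)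
    ultimately show ?thesis
      unfolding W_def W'_def by (auto intro!: derivative_eq_intros)
  qed
  have contW: "continuous_on {0..p} W"
    by (intro continuous_at_imp_continuous_on ballI DERIV_isCont[OF dW])
  have contW': "continuous_on {0..p} W'"
    unfolding W'_def by (intro continuous_intros continuous_on_compose2[OF cont]) auto
  have I1: "((\<lambda>h. K' h * W h + W' h * K h) has_integral (K p * W p - K 0 * W 0)) {0..p}"
  proof (rule fundamental_theorem_of_calculus)
    show "((\<lambda>h. K h * W h) has_vector_derivative (K' h * W h + W' h * K h)) (at h within {0..p})"
      if "h \<in> {0..p}" for h
      using DERIV_mult[OF der dW[OF that]]
      by (simp add: has_real_derivative_iff_has_vector_derivative[symmetric] has_field_derivative_at_within)
  qed (use p in auto)
  have I2: "((\<lambda>h. K' h * W h) has_integral integral {0..p} (\<lambda>h. K' h * W h)) {0..p}"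
    using contW contK' by (intro integrable_integral integrable_continuous_real continuous_intros)
      (auto intro: continuous_on_subset)
  have "integral {0..p} (\<lambda>h. W' h * K h) = K p * W p - integral {0..p} (\<lambda>h. K' h * W h)"
    using has_integral_diff[OF I1 I2] by (simp add: integral_unique W_def)
  moreover have "K p * W p \<le> 0" using K[of p] W[of p] p by (simp add: mult_nonneg_nonpos)
  moreover have "integral {0..p} (\<lambda>h. K' h * W h) \<ge> 0"
    using W K' contW contK'
    by (intro integral_nonneg integrable_continuous_real continuous_intros)
      (auto intro: continuous_on_subset mult_nonpos_nonpos)
  ultimately have le0: "integral {0..p} (\<lambda>h. W' h * K h) \<le> 0" by linarith
  define f where "f h = K h * (\<phi> (t + h) - c)" for h
  have contf: "continuous_on S f" for S
    unfolding f_def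
    by (intro continuous_intros continuous_on_compose2[OF cont] continuous_on_subset[OF contK]) auto
  have intf: "f integrable_on {x..y}" for x y by (intro integrable_continuous_real contf)
  have "integral {-p..p} f = integral {-p..0} f + integral {0..p} f"
    using Henstock_Kurzweil_Integration.integral_combine[OF _ _ intf, of "-p" 0 p] p by simp
  also have "integral {-p..0} f = integral {0..p} (\<lambda>h. f (- h))"
    using Henstock_Kurzweil_Integration.integral_reflect_real[of p 0 "\<lambda>h. f (- h)"] by simp
  also have "integral {0..p} (\<lambda>h. f (- h)) + integral {0..p} f = integral {0..p} (\<lambda>h. f (- h) + f h)"
    by (rule Henstock_Kurzweil_Integration.integral_add[symmetric])
       (auto intro!: integrable_continuous_real continuous_on_compose2[OF contf] continuous_intros intf)
  also have "(\<lambda>h. f (- h) + f h) = (\<lambda>h. W' h * K h)"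
    by (auto simp: f_def W'_def even algebra_simps)
  finally have "integral {-p..p} f \<le> 0" using le0 by simp
  moreover have "integral {-p..p} f = integral {-p..p} (\<lambda>h. K h * \<phi> (t + h)) - integral {-p..p} (\<lambda>h. c * K h)"
    unfolding f_def right_diff_distrib
    by (subst Henstock_Kurzweil_Integration.integral_diff[symmetric])
       (auto intro!: integrable_continuous_real continuous_intros continuous_on_compose2[OF cont] continuous_on_subset[OF contK] simp: mult_ac)
  ultimately show ?thesis by simp
qed

lemma cis_add_2pi: "cis (x + 2 * pi) = cis x"
  by (simp add: cis_mult[symmetric])

lemma radial_maximal_cover:
  assumes hol: "g holomorphic_on cball 0 R" and R: "0 < R" and c: "0 < c"
  obtains T where "T \<in> lmeasurable"
    "measure lebesgue T \<le> 10 / c * integral {0..2 * pi} (\<lambda>s. norm (g (of_real R * cis s)))"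
    "\<And>t r. \<lbrakk>t \<in> {0..2 * pi}; t \<notin> T; 0 \<le> r; r < R\<rbrakk> \<Longrightarrow> norm (g (of_real r * cis t)) \<le> c"
proof -
  define \<phi> where "\<phi> s = norm (g (of_real R * cis s))" for s
  have cg: "continuous_on (sphere 0 R) g"
    using holomorphic_on_imp_continuous_on[OF hol] by (rule continuous_on_subset) auto
  have cont: "continuous_on A \<phi>" for A
    unfolding \<phi>_def using R by (intro continuous_intros continuous_on_circle[OF cg]) auto
  have per: "\<phi> (x + 2 * pi) = \<phi> x" for x by (simp add: \<phi>_def cis_add_2pi)
  obtain T where T: "T \<in> lmeasurable" "measure lebesgue T \<le> 5 / c * integral {0 - pi..2 * pi + pi} \<phi>"
    "\<And>t h. \<lbrakk>t \<in> {0..2 * pi}; t \<notin> T; 0 < h; h \<le> pi\<rbrakk> \<Longrightarrow> integral {t - h..t + h} \<phi> \<le> 2 * h * c"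
    using maximal_function_cover[OF cont _ c, of 0 pi "2 * pi"] by (auto simp: \<phi>_def)
  have int: "\<phi> integrable_on {x..y}" for x y by (intro integrable_continuous_real cont)
  have "integral {-pi..3 * pi} \<phi> = integral {-pi..-pi + 2 * pi} \<phi> + integral {pi..pi + 2 * pi} \<phi>"
    using Henstock_Kurzweil_Integration.integral_combine[OF _ _ int, of "-pi" pi "3 * pi"] by simp
  also have "\<dots> = 2 * integral {0..2 * pi} \<phi>"
    by (subst (1 2) integral_periodic[OF cont per]) (use pi_gt_zero in linarith)+
  finally have m: "measure lebesgue T \<le> 10 / c * integral {0..2 * pi} \<phi>" using T(2) by simp
  have "norm (g (of_real r * cis t)) \<le> c" if t: "t \<in> {0..2 * pi}" "t \<notin> T" "0 \<le> r" "r < R" for t r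
  proof -
    define D where "D h = R\<^sup>2 + r\<^sup>2 - 2 * R * r * cos h" for h
    have D: "D h > 0" for h
    proof -
      have "(R - r)\<^sup>2 \<le> D h"
      proof -
        have "R * r * cos h \<le> R * r * 1" using R t by (intro mult_left_mono) auto
        then show ?thesis by (simp add: D_def power2_eq_square algebra_simps)
      qed
      moreover have "(R - r)\<^sup>2 > 0" using t by simp
      ultimately show ?thesis by linarith
    qed
    define N where "N = R\<^sup>2 - r\<^sup>2"
    have N: "N > 0" using t R by (simp add: N_def power_strict_mono)
    define K where "K h = N / D h" for h
    define K' where "K' h = - N * (2 * R * r * sin h) / (D h)\<^sup>2" for h
    have P: "poisson_kernel (of_real r * cis t') (of_real R * cis (t' + h)) = K h" for t' h
      by (simp add: poisson_kernel_rotate K_def N_def D_def)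
    have contD: "continuous_on A D" for A
      unfolding D_def by (intro continuous_intros)
    have D0: "D h \<noteq> 0" for h using D[of h] by simp
    have contK: "continuous_on A K" for A
      unfolding K_def using D0 by (intro continuous_intros contD) auto
    have perK: "K (x + 2 * pi) = K x" for x by (simp add: K_def D_def)
    have zr: "norm (of_real r * cis s) < R" for s using t by (simp add: norm_mult)
    have "integral {-pi..pi} K = integral {-pi..-pi + 2 * pi} K" by simp
    also have "\<dots> = integral {0..2 * pi} K"
      by (rule integral_periodic[OF contK perK]) (use pi_gt_zero in linarith)+
    also have "\<dots> = 2 * pi"
      using Poisson_kernel_integral[OF zr[of 0]] P[of 0] by (simp add: integral_unique)
    finally have IK: "integral {-pi..pi} K = 2 * pi" .
    have bound: "integral {-pi..pi} (\<lambda>h. K h * \<phi> (t + h)) \<le> c * integral {-pi..pi} K"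
    proof (rule decreasing_kernel_bound)
      show "(K has_real_derivative K' h) (at h)" for h
        unfolding K_def K'_def using D0[of h] unfolding D_def
        by (auto intro!: derivative_eq_intros simp: power2_eq_square)
      show "continuous_on UNIV K'"
        unfolding K'_def using D0 by (intro continuous_intros contD) auto
      show "K' h \<le> 0" if "h \<in> {0..pi}" for h
        using that N R t sin_ge_zero[of h] by (auto simp: K'_def intro!: divide_nonpos_nonneg)
      show "0 \<le> K h" for h using N D[of h] by (simp add: K_def)
      show "K (- h) = K h" for h by (simp add: K_def D_def)
    qed (use T(3)[OF t(1,2)] cont in auto)
    define \<psi> where "\<psi> s = poisson_kernel (of_real r * cis t) (of_real R * cis s) * \<phi> s" for s
    have \<psi>: "\<psi> (t + h) = K h * \<phi> (t + h)" for h by (simp add: \<psi>_def P)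
    have cont\<psi>: "continuous_on UNIV \<psi>"
      unfolding \<psi>_def by (intro continuous_intros cont continuous_on_poisson_kernel zr)
    have "2 * pi * norm (g (of_real r * cis t)) \<le> integral {0..2 * pi} \<psi>"
      using Poisson_inequality[OF hol zr] unfolding \<psi>_def \<phi>_def by simp
    also have "\<dots> = integral {t - pi..t - pi + 2 * pi} \<psi>"
      by (rule integral_periodic[symmetric, OF cont\<psi>]) (use t in \<open>auto simp: \<psi>_def cis_add_2pi per\<close>)
    also have "\<dots> = integral {-pi..pi} (\<lambda>h. \<psi> (t + h))"
      using integral_shift_real_ivl[of "t - pi" t "t + pi" \<psi>] by (simp add: add.commute)
    also have "\<dots> \<le> c * (2 * pi)" using bound unfolding \<psi> IK .
    finally show ?thesis by simp
  qed
  then show thesis using that[OF T(1)] m unfolding \<phi>_def by blast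
qed

lemma Littlewood_subordination_L1:
  assumes h: "h holomorphic_on cball 0 1" and v: "v holomorphic_on cball 0 r" and r: "0 < r"
    and v1: "\<And>z. z \<in> cball 0 r \<Longrightarrow> norm (v z) < 1"
  shows "integral {0..2 * pi} (\<lambda>t. norm (h (v (of_real r * cis t))))
       \<le> (1 + norm (v 0)) / (1 - norm (v 0)) * integral {0..2 * pi} (\<lambda>s. norm (h (cis s)))"
proof -
  define w where "w t = v (of_real r * cis t)" for t
  have in_r: "of_real r * cis t \<in> cball 0 r" for t using r by (simp add: norm_mult)
  have w1: "norm (w t) < 1" for t using v1[OF in_r] by (simp add: w_def)
  have contw: "continuous_on A w" for A
    unfolding w_def
    by (intro continuous_on_compose2[OF holomorphic_on_imp_continuous_on[OF v]] continuous_intros) (use in_r in auto)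
  have conth: "continuous_on A (\<lambda>s. h (cis s))" for A :: "real set"
    by (intro continuous_on_compose2[OF holomorphic_on_imp_continuous_on[OF h]] continuous_intros) auto
  have conthw: "continuous_on A (\<lambda>t. h (w t))" for A
    using less_imp_le[OF w1] by (intro continuous_on_compose2[OF holomorphic_on_imp_continuous_on[OF h]] contw) auto
  define f where "f t s = poisson_kernel (w t) (cis s) * norm (h (cis s))" for t s
  have ne: "cis s \<noteq> z" if "norm z < 1" for s z using that by auto
  have contf: "continuous_on (cbox (0, 0) (2 * pi, 2 * pi)) (\<lambda>(t, s). f t s)"
    unfolding f_def poisson_kernel_def split_beta using w1 ne
    by (intro continuous_intros continuous_on_compose2[OF contw[of UNIV]] continuous_on_compose2[OF conth[of UNIV]]) auto
  have mean: "integral {0..2 * pi} (\<lambda>t. poisson_kernel (w t) (cis s)) = 2 * pi * poisson_kernel (v 0) (cis s)" for s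
  proof -
    have "(\<lambda>z. (cis s + v z) / (cis s - v z)) holomorphic_on cball 0 r"
      using v1 ne by (intro holomorphic_intros v) (auto simp: eq_iff_diff_eq_0[symmetric])
    from integral_unique[OF has_integral_Re[OF circle_mean[OF this r]]]
    have "integral {0..2 * pi} (\<lambda>t. poisson_kernel (w t) (cis s)) = Re (of_real (2 * pi) * ((cis s + v 0) / (cis s - v 0)))"
      by (simp add: poisson_kernel_Re w_def)
    also have "\<dots> = 2 * pi * poisson_kernel (v 0) (cis s)"
      unfolding poisson_kernel_Re by (simp only: times_complex.simps Re_complex_of_real Im_complex_of_real)
    finally show ?thesis .
  qed
  have contP: "continuous_on {0..2 * pi} (\<lambda>s. f t s)" "continuous_on {0..2 * pi} (\<lambda>t. f t s)" for s t
    unfolding f_def poisson_kernel_def using w1 ne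
    by (auto intro!: continuous_intros contw conth)
  have I: "(\<lambda>t. integral {0..2 * pi} (f t)) integrable_on {0..2 * pi}"
    using integral_integrable_2dim[OF contf] by simp
  have "2 * pi * integral {0..2 * pi} (\<lambda>t. norm (h (w t))) = integral {0..2 * pi} (\<lambda>t. 2 * pi * norm (h (w t)))"
    by simp
  also have "\<dots> \<le> integral {0..2 * pi} (\<lambda>t. integral {0..2 * pi} (f t))"
  proof (rule integral_le[OF _ I])
    show "2 * pi * norm (h (w t)) \<le> integral {0..2 * pi} (f t)" for t
      using Poisson_inequality[OF h w1[of t]] by (simp add: f_def[abs_def])
  qed (intro integrable_continuous_real continuous_intros conthw)
  also have "\<dots> = integral {0..2 * pi} (\<lambda>s. integral {0..2 * pi} (\<lambda>t. f t s))"
    using integral_swap_continuous[OF contf] by simp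
  also have "\<dots> = integral {0..2 * pi} (\<lambda>s. 2 * pi * (poisson_kernel (v 0) (cis s) * norm (h (cis s))))"
  proof -
    have "integral {0..2 * pi} (\<lambda>t. f t s) = 2 * pi * (poisson_kernel (v 0) (cis s) * norm (h (cis s)))" for s
      unfolding f_def Henstock_Kurzweil_Integration.integral_mult_left mean by (simp only: mult.assoc)
    then show ?thesis by simp
  qed
  also have "\<dots> \<le> integral {0..2 * pi} (\<lambda>s. 2 * pi * ((1 + norm (v 0)) / (1 - norm (v 0)) * norm (h (cis s))))"
  proof (rule integral_le)
    have v0: "norm (v 0) < 1" using v1 r by simp
    show "2 * pi * (poisson_kernel (v 0) (cis s) * norm (h (cis s)))
        \<le> 2 * pi * ((1 + norm (v 0)) / (1 - norm (v 0)) * norm (h (cis s)))" for s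
      using poisson_kernel_le[of "v 0" "cis s"] v0 by (intro mult_left_mono mult_right_mono) auto
    show "(\<lambda>s. 2 * pi * (poisson_kernel (v 0) (cis s) * norm (h (cis s)))) integrable_on {0..2 * pi}"
      using continuous_on_poisson_kernel[of "v 0" 1] v0
      by (intro integrable_continuous_real continuous_intros conth) auto
  qed (intro integrable_continuous_real continuous_intros conth)
  also have "\<dots> = 2 * pi * ((1 + norm (v 0)) / (1 - norm (v 0)) * integral {0..2 * pi} (\<lambda>s. norm (h (cis s))))"
    by simp
  finally show ?thesis
    unfolding w_def by (rule mult_left_le_imp_le) simp
qed

subsection \<open>Harmonic majorants of small sets\<close>

lemma norm_cis_diff_le: "norm (cis a - cis b) \<le> \<bar>a - b\<bar>"
proof -
  have half: "2 * ((a - b) / 2) = a - b" by simp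
  have "(norm (cis a - cis b))\<^sup>2 = (cos a - cos b)\<^sup>2 + (sin a - sin b)\<^sup>2"
    by (simp add: cmod_power2)
  also have "\<dots> = ((sin a)\<^sup>2 + (cos a)\<^sup>2) + ((sin b)\<^sup>2 + (cos b)\<^sup>2) - 2 * cos (a - b)"
    by (simp add: power2_eq_square algebra_simps cos_diff del: sin_cos_squared_add sin_cos_squared_add2 sin_cos_squared_add3)
  also have "\<dots> = 2 - 2 * cos (2 * ((a - b) / 2))"
    by (simp add: half del: times_divide_eq_right)
  also have "\<dots> = (2 * sin ((a - b) / 2))\<^sup>2"
    by (subst cos_double_sin) (simp add: power_mult_distrib)
  finally have "norm (cis a - cis b) = \<bar>2 * sin ((a - b) / 2)\<bar>"
    using power2_eq_iff_nonneg[of "norm (cis a - cis b)" "\<bar>2 * sin ((a - b) / 2)\<bar>"] by simp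
  also have "\<dots> \<le> \<bar>a - b\<bar>" using abs_sin_x_le_abs_x[of "(a - b) / 2"] by simp
  finally show ?thesis .
qed

lemma compact_cover_by_arcs:
  assumes E: "compact E" "E \<subseteq> {0..c}" and m: "measure lebesgue E < \<epsilon>" and c: "0 < c"
  obtains l J where "0 < l" "finite (J :: nat set)" "real (card J) * l < \<epsilon>"
    "\<And>t. t \<in> E \<Longrightarrow> \<exists>j\<in>J. \<bar>l * real j - t\<bar> \<le> l"
proof -
  have El: "E \<in> lmeasurable" using E(1) by (rule lmeasurable_compact)
  obtain V where V: "open V" "E \<subseteq> V" "V - E \<in> lmeasurable" "emeasure lebesgue (V - E) < ennreal (\<epsilon> - measure lebesgue E)"
    using sets_lebesgue_outer_open[of E "\<epsilon> - measure lebesgue E"] El m by (auto simp: fmeasurableD)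
  have VE: "V = E \<union> (V - E)" using V by auto
  have Vl: "V \<in> lmeasurable" using El V(3) VE by (metis fmeasurable.Un)
  have "measure lebesgue (V - E) < \<epsilon> - measure lebesgue E"
    using V(3,4) m by (simp add: emeasure_eq_measure2 ennreal_less_iff)
  moreover have "measure lebesgue V \<le> measure lebesgue E + measure lebesgue (V - E)"
    using measure_Un_le[of E lebesgue "V - E"] El V(3) VE by (metis fmeasurableD)
  ultimately have mV: "measure lebesgue V < \<epsilon>" by linarith
  obtain d where d: "d > 0" "(\<Union>x\<in>E. ball x d) \<subseteq> V"
    using compact_subset_open_imp_ball_epsilon_subset[OF E(1) V(1,2)] by blast
  obtain n :: nat where n: "c < real n * d" using reals_Archimedean3[OF d(1)] by blast
  have n0: "n > 0" using n c d(1) by (cases n) auto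
  define l where "l = c / real n"
  have l: "0 < l" "l < d" using n n0 c by (auto simp: l_def field_simps)
  define I where "I j = {l * real j..<l * real (j + 1)}" for j :: nat
  define J where "J = {j \<in> {..n}. I j \<inter> E \<noteq> {}}"
  have fJ: "finite J" by (simp add: J_def)
  have IV: "I j \<subseteq> V" if jJ: "j \<in> J" for j
  proof
    fix x assume x: "x \<in> I j"
    obtain e where e: "e \<in> I j" "e \<in> E" using jJ unfolding J_def by blast
    have "\<bar>e - x\<bar> < l" using x e(1) by (auto simp: I_def abs_if algebra_simps)
    then have "x \<in> ball e d" using l by (simp add: dist_real_def)
    then show "x \<in> V" using d(2) e(2) by blast
  qed
  have disj: "disjnt (I i) (I j)" if "i \<noteq> j" for i j
  proof -
    have "I i \<inter> I j = {}" if "i < j" for i j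
    proof -
      have "l * real (i + 1) \<le> l * real j" using that l by (intro mult_left_mono) auto
      then show ?thesis by (auto simp: I_def)
    qed
    then show ?thesis using that by (metis disjnt_def inf_commute nat_neq_iff)
  qed
  have Il: "I j \<in> lmeasurable" for j
    by (rule bounded_set_imp_lmeasurable) (auto simp: I_def intro: bounded_subset[OF bounded_closed_interval])
  have mI: "measure lebesgue (I j) = l" for j using l by (simp add: I_def algebra_simps)
  have "real (card J) * l = (\<Sum>j\<in>J. measure lebesgue (I j))" by (simp add: mI)
  also have "\<dots> = measure lebesgue (\<Union>j\<in>J. I j)"
    by (rule measure_UNION'[symmetric]) (use fJ disj Il in \<open>auto simp: pairwise_def\<close>)
  also have "\<dots> \<le> measure lebesgue V"
    by (rule measure_mono_fmeasurable) (use IV Vl fJ Il in \<open>auto intro: fmeasurableD\<close>)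
  finally have card: "real (card J) * l < \<epsilon>" using mV by linarith
  have cov: "\<exists>j\<in>J. \<bar>l * real j - t\<bar> \<le> l" if t: "t \<in> E" for t
  proof -
    define j where "j = nat \<lfloor>t / l\<rfloor>"
    have t0: "0 \<le> t" "t \<le> c" using t E by auto
    have "real j \<le> t / l" "t / l < real j + 1" using t0 l by (auto simp: j_def)
    then have tj: "l * real j \<le> t" "t < l * (real j + 1)" using l by (auto simp: field_simps)
    have "t / l \<le> real n" using t0 l n0 by (simp add: l_def field_simps)
    then have "real j \<le> real n" using \<open>real j \<le> t / l\<close> by linarith
    moreover have "t \<in> I j" using tj by (simp add: I_def add.commute)
    ultimately have "j \<in> J" using t by (auto simp: J_def)
    moreover have "\<bar>l * real j - t\<bar> \<le> l" using tj by (simp add: algebra_simps)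
    ultimately show ?thesis by blast
  qed
  show thesis by (rule that[OF l(1) fJ card cov])
qed

text \<open>The majorant is a sum of Poisson kernels with poles just outside the disk, one for each short
  arc meeting \<open>E\<close>.\<close>
lemma harmonic_majorant_of_small_set:
  assumes E: "compact E" "E \<subseteq> {0..2 * pi}" and m: "measure lebesgue E < \<epsilon>"
  obtains Q R where "1 < R" "Q holomorphic_on ball 0 R" "\<And>z. norm z \<le> 1 \<Longrightarrow> 0 \<le> Re (Q z)"
    "\<And>t. t \<in> E \<Longrightarrow> 1 \<le> Re (Q (cis t))" "\<And>z. norm z < 1 \<Longrightarrow> norm (Q z) \<le> 4 * \<epsilon> / (1 - norm z)"
proof -
  obtain l and J :: "nat set" where lJ: "0 < l" "finite J" "real (card J) * l < \<epsilon>"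
    "\<And>t. t \<in> E \<Longrightarrow> \<exists>j\<in>J. \<bar>l * real j - t\<bar> \<le> l"
    using compact_cover_by_arcs[OF E m] by auto
  define e where "e j = of_real (1 + l) * cis (l * real j)" for j :: nat
  have ne: "norm (e j) = 1 + l" for j using lJ(1) unfolding e_def norm_mult norm_of_real by simp
  define q where "q j z = (e j + z) / (e j - z)" for j z
  define Q where "Q z = of_real (2 * l) * (\<Sum>j\<in>J. q j z)" for z
  have neq: "e j \<noteq> z" if "norm z < 1 + l" for j z using ne[of j] that by auto
  have ReQ: "Re (Q z) = 2 * l * (\<Sum>j\<in>J. poisson_kernel z (e j))" for z
    by (simp add: Q_def q_def poisson_kernel_Re)
  have pos: "0 \<le> poisson_kernel z (e j)" if "norm z \<le> 1" for z j
    using that lJ(1) by (intro poisson_kernel_nonneg) (simp add: ne)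
  show thesis
  proof
    show "1 < 1 + l" using lJ by simp
    show "Q holomorphic_on ball 0 (1 + l)"
      unfolding Q_def q_def using neq by (intro holomorphic_intros) (auto simp: eq_iff_diff_eq_0[symmetric])
    show "0 \<le> Re (Q z)" if "norm z \<le> 1" for z
      unfolding ReQ using pos[OF that] lJ by (intro mult_nonneg_nonneg sum_nonneg) auto
    show "1 \<le> Re (Q (cis t))" if tE: "t \<in> E" for t
    proof -
      obtain j where j: "j \<in> J" "\<bar>l * real j - t\<bar> \<le> l" using lJ(4)[OF tE] by blast
      have "e j - cis t = of_real l * cis (l * real j) + (cis (l * real j) - cis t)"
        by (simp add: e_def algebra_simps)
      then have "norm (e j - cis t) \<le> norm (of_real l * cis (l * real j)) + norm (cis (l * real j) - cis t)"
        by (metis norm_triangle_ineq)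
      also have "\<dots> \<le> l + l"
        using norm_cis_diff_le[of "l * real j" t] j(2) lJ(1) by (simp add: norm_mult)
      finally have d: "norm (e j - cis t) \<le> 2 * l" by simp
      have "e j \<noteq> cis t" using lJ(1) by (intro neq) auto
      then have d0: "0 < norm (e j - cis t)" by simp
      have "1 / (2 * l) = 2 * l / (2 * l)\<^sup>2" using lJ(1) by (simp add: power2_eq_square)
      also have "\<dots> \<le> ((1 + l)\<^sup>2 - 1\<^sup>2) / (norm (e j - cis t))\<^sup>2"
        using d d0 lJ(1) by (intro frac_le power_mono) (auto simp: power2_eq_square algebra_simps)
      also have "\<dots> = poisson_kernel (cis t) (e j)"
        by (simp add: poisson_kernel_def ne)
      finally have "1 \<le> 2 * l * poisson_kernel (cis t) (e j)"
        using lJ(1) by (simp add: field_simps)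
      also have "\<dots> \<le> Re (Q (cis t))"
        unfolding ReQ using j(1) lJ(1,2) pos[of "cis t"] by (intro mult_left_mono member_le_sum) auto
      finally show ?thesis .
    qed
    show "norm (Q z) \<le> 4 * \<epsilon> / (1 - norm z)" if z: "norm z < 1" for z
    proof -
      have q: "norm (q j z) \<le> 2 / (1 - norm z)" for j
      proof -
        have "norm (e j - z) \<ge> 1 + l - norm z" using norm_triangle_ineq2[of "e j" z] ne by simp
        moreover have "norm (e j + z) \<le> 1 + l + norm z" using norm_triangle_ineq[of "e j" z] ne by simp
        ultimately have "norm (q j z) \<le> (1 + l + norm z) / (1 + l - norm z)"
          unfolding q_def norm_divide using z lJ(1) by (intro frac_le) auto
        also have "\<dots> \<le> 2 / (1 - norm z)"
        proof -
          have "(1 + l + norm z) * (1 - norm z) \<le> 2 * (1 + l - norm z)"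
          proof -
            have "2 * (1 + l - norm z) - (1 + l + norm z) * (1 - norm z) = (1 - norm z)\<^sup>2 + l * (1 + norm z)"
              by (simp add: power2_eq_square algebra_simps)
            moreover have "0 \<le> (1 - norm z)\<^sup>2 + l * (1 + norm z)" using lJ(1) by simp
            ultimately show ?thesis by linarith
          qed
          then show ?thesis using z lJ(1) by (simp add: divide_simps)
        qed
        finally show ?thesis .
      qed
      have "norm (Q z) \<le> 2 * l * (\<Sum>j\<in>J. 2 / (1 - norm z))"
        unfolding Q_def norm_mult using lJ(1) q
        by (intro mult_mono sum_norm_le) (auto intro: sum_nonneg)
      also have "\<dots> = (real (card J) * l) * (4 / (1 - norm z))" by simp
      also have "\<dots> \<le> \<epsilon> * (4 / (1 - norm z))" using lJ(3) z by (intro mult_right_mono) auto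
      finally show ?thesis by (simp add: mult.commute)
    qed
  qed
qed

subsection \<open>Boundary behaviour of inner functions\<close>

lemma AE_lebesgue_on_iff_negligible:
  fixes S :: "'a::euclidean_space set"
  assumes "S \<in> sets lebesgue"
  shows "(AE t in lebesgue_on S. P t) \<longleftrightarrow> negligible {t \<in> S. \<not> P t}"
proof -
  have "(AE t in lebesgue_on S. P t) \<longleftrightarrow> (AE t in lebesgue. t \<in> S \<longrightarrow> P t)"
    using assms by (intro AE_restrict_space_iff) auto
  also have "\<dots> \<longleftrightarrow> (\<exists>N. negligible N \<and> {t \<in> S. \<not> P t} \<subseteq> N)"
    unfolding eventually_ae_filter negligible_iff_null_sets by auto
  also have "\<dots> \<longleftrightarrow> negligible {t \<in> S. \<not> P t}"
    using negligible_subset by blast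
  finally show ?thesis .
qed

lemma bounded_convergence_const:
  fixes f :: "nat \<Rightarrow> real \<Rightarrow> real"
  assumes cont: "\<And>k. continuous_on {a..b} (f k)" and B: "\<And>k t. t \<in> {a..b} \<Longrightarrow> \<bar>f k t\<bar> \<le> B"
    and N: "negligible N" and lim: "\<And>t. t \<in> {a..b} - N \<Longrightarrow> (\<lambda>k. f k t) \<longlonglongrightarrow> c" and ab: "a \<le> b"
  shows "(\<lambda>k. integral {a..b} (f k)) \<longlonglongrightarrow> (b - a) * c"
proof -
  define g where "g k t = (if t \<in> N then c else f k t)" for k t
  have g: "g k integrable_on {a..b}" for k
    by (rule integrable_spike[OF integrable_continuous_real[OF cont[of k]] N]) (simp add: g_def)
  have "integral {a..b} (f k) = integral {a..b} (g k)" for k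
    by (rule integral_spike[OF N]) (simp add: g_def)
  moreover have "(\<lambda>k. integral {a..b} (g k)) \<longlonglongrightarrow> integral {a..b} (\<lambda>_. c)"
  proof (rule dominated_convergence(2))
    show "norm (g k t) \<le> max B \<bar>c\<bar>" if "t \<in> {a..b}" for k t
      using B[OF that, of k] by (auto simp: g_def)
    show "(\<lambda>k. g k t) \<longlonglongrightarrow> c" if "t \<in> {a..b}" for t
      using lim[of t] that by (cases "t \<in> N") (auto simp: g_def)
  qed (use g in auto)
  ultimately show ?thesis using ab by simp
qed

lemma Markov_superlevel:
  fixes f :: "real \<Rightarrow> real"
  assumes cont: "continuous_on {a..b} f" and f: "\<And>t. t \<in> {a..b} \<Longrightarrow> 0 \<le> f t" and c: "0 < c"
  shows "compact {t \<in> {a..b}. c \<le> f t}" "measure lebesgue {t \<in> {a..b}. c \<le> f t} \<le> integral {a..b} f / c"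
proof -
  define S where "S = {t \<in> {a..b}. c \<le> f t}"
  have "closed S" unfolding S_def by (intro continuous_on_closed_Collect_le cont continuous_intros)
  moreover have "bounded S" by (rule bounded_subset[of "{a..b}"]) (auto simp: S_def)
  ultimately have S: "compact S" by (simp add: compact_eq_bounded_closed)
  then show "compact {t \<in> {a..b}. c \<le> f t}" by (simp add: S_def)
  have Sl: "S \<inter> {a..b} \<in> lmeasurable" using S by (intro lmeasurable_compact compact_Int) auto
  have SS: "S \<inter> {a..b} = S" by (auto simp: S_def)
  have "c * measure lebesgue S = integral {a..b} (\<lambda>t. c * indicator S t)"
    using Equivalence_Lebesgue_Henstock_Integration.integral_indicator[OF Sl] by (simp add: SS)
  also have "\<dots> \<le> integral {a..b} f"
  proof (rule integral_le)
    have "(indicator S :: real \<Rightarrow> real) integrable_on {a..b}" using Sl by (simp add: integrable_on_indicator)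
    then show "(\<lambda>t. c * indicator S t) integrable_on {a..b}" using c by (simp add: integrable_on_cmult_iff)
    show "c * indicator S t \<le> f t" if "t \<in> {a..b}" for t
      using f that by (auto simp: indicator_def S_def)
  qed (intro integrable_continuous_real cont)
  finally show "measure lebesgue {t \<in> {a..b}. c \<le> f t} \<le> integral {a..b} f / c"
    using c by (simp add: field_simps S_def)
qed

definition disk_radius :: "nat \<Rightarrow> real" where
  "disk_radius k = 1 - inverse (real k + 2)"

lemma disk_radius: "0 < disk_radius k" "disk_radius k < 1" "0 \<le> disk_radius k"
  by (auto simp: disk_radius_def field_simps)

lemma disk_radius_LIMSEQ: "disk_radius \<longlonglongrightarrow> 1"
  unfolding disk_radius_def by real_asymp

lemma filterlim_disk_radius: "filterlim disk_radius (at_left 1) sequentially"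
  unfolding filterlim_at using disk_radius_LIMSEQ disk_radius by (auto intro!: always_eventually simp: less_imp_neq)

lemma eventually_disk_radius_gt: "x < 1 \<Longrightarrow> \<forall>\<^sub>F k in sequentially. x < disk_radius k"
  using order_tendstoD(1)[OF disk_radius_LIMSEQ] .

lemma has_radial_limit_LIMSEQ:
  "has_radial_limit u l \<zeta> \<Longrightarrow> (\<lambda>k. u (of_real (disk_radius k) * \<zeta>)) \<longlonglongrightarrow> l"
  unfolding has_radial_limit_def by (rule filterlim_compose[OF _ filterlim_disk_radius])

lemma inner_function_holomorphic: "inner_function u \<Longrightarrow> u holomorphic_on ball 0 1"
  by (simp add: inner_function_def H_infinity_def)

lemma inner_function_radial_limits:
  assumes "inner_function u"
  obtains N where "negligible N"
    "\<And>t. t \<in> {0..2 * pi} - N \<Longrightarrow> \<exists>l. has_radial_limit u l (cis t) \<and> norm l = 1"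
proof
  show "negligible {t \<in> {0..2 * pi}. \<not> (\<exists>l. has_radial_limit u l (cis t) \<and> norm l = 1)}"
    using assms unfolding inner_function_def by (subst AE_lebesgue_on_iff_negligible[symmetric]) auto
qed auto

lemma holomorphic_on_cball_disk:
  assumes "u holomorphic_on ball 0 1" "r < 1"
  shows "u holomorphic_on cball (0::complex) r"
  using assms(2) by (intro holomorphic_on_subset[OF assms(1)]) auto

lemma continuous_on_circle_disk:
  assumes "u holomorphic_on ball 0 1" "0 \<le> r" "r < 1"
  shows "continuous_on A (\<lambda>t. u (of_real r * cis t))"
  using assms
  by (intro continuous_on_circle continuous_on_subset[OF holomorphic_on_imp_continuous_on[OF assms(1)]]) auto

text \<open>Applying Poisson's inequality to the powers \<open>u ^ n\<close> removes the constant coming from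
  the kernel.\<close>
lemma inner_function_le_one:
  assumes u: "inner_function u" and z: "norm z < 1"
  shows "norm (u z) \<le> 1"
proof -
  note hol = inner_function_holomorphic[OF u]
  obtain N where N: "negligible N"
    "\<And>t. t \<in> {0..2 * pi} - N \<Longrightarrow> \<exists>l. has_radial_limit u l (cis t) \<and> norm l = 1"
    using inner_function_radial_limits[OF u] by metis
  obtain B where B: "\<And>w. w \<in> ball 0 1 \<Longrightarrow> norm (u w) \<le> B"
    using u unfolding inner_function_def H_infinity_def bounded_iff by blast
  define C where "C = 4 / (1 - norm z)"
  have pow: "norm (u z) ^ n \<le> C" for n
  proof -
    define I where "I k = integral {0..2 * pi} (\<lambda>t. norm (u (of_real (disk_radius k) * cis t)) ^ n)" for k
    have cont: "continuous_on A (\<lambda>t. norm (u (of_real (disk_radius k) * cis t)) ^ n)" for k A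
      using disk_radius by (intro continuous_intros continuous_on_circle_disk[OF hol]) auto
    have "I \<longlonglongrightarrow> (2 * pi - 0) * 1"
      unfolding I_def
    proof (rule bounded_convergence_const[OF cont _ N(1)])
      show "\<bar>norm (u (of_real (disk_radius k) * cis t)) ^ n\<bar> \<le> B ^ n" for k t
        using B[of "of_real (disk_radius k) * cis t"] disk_radius[of k]
        by (auto simp: norm_mult intro!: power_mono)
      show "(\<lambda>k. norm (u (of_real (disk_radius k) * cis t)) ^ n) \<longlonglongrightarrow> 1" if t: "t \<in> {0..2 * pi} - N" for t
      proof -
        obtain l where l: "has_radial_limit u l (cis t)" "norm l = 1" using N(2)[OF t] by blast
        show ?thesis using tendsto_power[OF tendsto_norm[OF has_radial_limit_LIMSEQ[OF l(1)]], of n] l(2) by simp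
      qed
    qed auto
    then have lim: "(\<lambda>k. C * I k) \<longlonglongrightarrow> C * (2 * pi)" by (intro tendsto_intros) simp
    have "\<forall>\<^sub>F k in sequentially. (1 + norm z) / 2 < disk_radius k"
      using z by (intro eventually_disk_radius_gt) auto
    then have ev: "\<forall>\<^sub>F k in sequentially. 2 * pi * norm (u z) ^ n \<le> C * I k"
    proof eventually_elim
      case (elim k)
      define R where "R = disk_radius k"
      have R: "norm z < R" "R < 1" "(1 - norm z) / 2 < R - norm z"
        using elim z disk_radius[of k] by (auto simp: R_def field_simps)
      have contR: "continuous_on A (\<lambda>t. u (of_real R * cis t))" for A
        unfolding R_def using disk_radius by (intro continuous_on_circle_disk[OF hol]) auto
      have "2 * pi * norm (u z ^ n)
          \<le> integral {0..2 * pi} (\<lambda>t. poisson_kernel z (of_real R * cis t) * norm (u (of_real R * cis t) ^ n))"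
        using R by (intro Poisson_inequality holomorphic_intros holomorphic_on_cball_disk[OF hol]) auto
      also have "\<dots> \<le> integral {0..2 * pi} (\<lambda>t. C * norm (u (of_real R * cis t)) ^ n)"
      proof (rule integral_le)
        have nR: "norm (of_real R * cis t) = R" for t using disk_radius[of k] by (simp add: norm_mult R_def)
        have "poisson_kernel z (of_real R * cis t) \<le> C" for t
        proof -
          have "poisson_kernel z (of_real R * cis t) \<le> (R + norm z) / (R - norm z)"
            using poisson_kernel_le[of z "of_real R * cis t"] R nR by simp
          also have "\<dots> \<le> 2 / ((1 - norm z) / 2)" using R z by (intro frac_le) auto
          finally show ?thesis by (simp add: C_def)
        qed
        then show "poisson_kernel z (of_real R * cis t) * norm (u (of_real R * cis t) ^ n)
            \<le> C * norm (u (of_real R * cis t)) ^ n" for t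
          unfolding norm_power by (intro mult_right_mono) auto
        show "(\<lambda>t. poisson_kernel z (of_real R * cis t) * norm (u (of_real R * cis t) ^ n)) integrable_on {0..2 * pi}"
          using R by (intro integrable_continuous_real continuous_intros continuous_on_poisson_kernel contR) auto
      qed (intro integrable_continuous_real continuous_intros contR)
      also have "\<dots> = C * I k" by (simp add: I_def R_def)
      finally show ?case by (simp add: norm_power)
    qed
    have "2 * pi * norm (u z) ^ n \<le> C * (2 * pi)"
      by (rule tendsto_lowerbound[OF lim ev]) simp
    then show ?thesis by (simp add: mult.commute)
  qed
  show ?thesis
  proof (rule ccontr)
    assume "\<not> ?thesis"
    then obtain n where "C < norm (u z) ^ n" using real_arch_pow[of "norm (u z)" C] by auto
    then show False using pow[of n] by simp
  qed
qed

lemma inner_function_less_one: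
  assumes u: "inner_function u" "\<not> u constant_on ball 0 1" and z: "norm z < 1"
  shows "norm (u z) < 1"
proof (rule ccontr)
  assume "\<not> ?thesis"
  then have "norm (u w) \<le> norm (u z)" if "w \<in> ball 0 1" for w
    using inner_function_le_one[OF u(1), of w] that by simp
  then have "u constant_on ball 0 1"
    using z by (intro maximum_modulus_principle[OF inner_function_holomorphic[OF u(1)], of "ball 0 1" z]) auto
  then show False using u(2) by simp
qed

lemma inner_function_small_values:
  assumes u: "inner_function u" and \<kappa>: "\<kappa> < 1"
  defines "S \<equiv> (\<lambda>k. {t \<in> {0..2 * pi}. norm (u (of_real (disk_radius k) * cis t)) \<le> \<kappa>})"
  shows "compact (S k)" "(\<lambda>k. measure lebesgue (S k)) \<longlonglongrightarrow> 0"
proof -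
  note hol = inner_function_holomorphic[OF u]
  obtain N where N: "negligible N"
    "\<And>t. t \<in> {0..2 * pi} - N \<Longrightarrow> \<exists>l. has_radial_limit u l (cis t) \<and> norm l = 1"
    using inner_function_radial_limits[OF u] by metis
  define f where "f k t = 1 - norm (u (of_real (disk_radius k) * cis t))" for k t
  have S: "S k = {t \<in> {0..2 * pi}. 1 - \<kappa> \<le> f k t}" for k by (auto simp: S_def f_def)
  have cont: "continuous_on A (f k)" for A k
    unfolding f_def using disk_radius by (intro continuous_intros continuous_on_circle_disk[OF hol]) auto
  have f: "0 \<le> f k t" for k t
    using inner_function_le_one[OF u, of "of_real (disk_radius k) * cis t"] disk_radius[of k]
    by (simp add: f_def norm_mult)
  have M: "compact (S k)" "measure lebesgue (S k) \<le> integral {0..2 * pi} (f k) / (1 - \<kappa>)" for k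
    unfolding S using Markov_superlevel[OF cont f, of "1 - \<kappa>"] \<kappa> by auto
  show "compact (S k)" by (rule M)
  have "(\<lambda>k. integral {0..2 * pi} (f k)) \<longlonglongrightarrow> (2 * pi - 0) * 0"
  proof (rule bounded_convergence_const[OF cont _ N(1)])
    show "\<bar>f k t\<bar> \<le> 1" for k t using f[of k t] by (simp add: f_def)
    show "(\<lambda>k. f k t) \<longlonglongrightarrow> 0" if t: "t \<in> {0..2 * pi} - N" for t
    proof -
      obtain l where l: "has_radial_limit u l (cis t)" "norm l = 1" using N(2)[OF t] by blast
      show ?thesis
        using tendsto_diff[OF tendsto_const[of 1] tendsto_norm[OF has_radial_limit_LIMSEQ[OF l(1)]]] l(2)
        by (simp add: f_def)
    qed
  qed auto
  then have lim: "(\<lambda>k. integral {0..2 * pi} (f k) / (1 - \<kappa>)) \<longlonglongrightarrow> 0 / (1 - \<kappa>)"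
    using \<kappa> by (intro tendsto_intros) auto
  show "(\<lambda>k. measure lebesgue (S k)) \<longlonglongrightarrow> 0"
    by (rule tendsto_sandwich[OF _ _ tendsto_const[of 0]]) (use M(2) lim in auto)
qed

lemma inner_function_L1_Cauchy:
  assumes u: "inner_function u" and e: "0 < e"
  obtains J where "\<And>i j. \<lbrakk>J \<le> i; J \<le> j\<rbrakk> \<Longrightarrow>
    integral {0..2 * pi} (\<lambda>t. norm (u (of_real (disk_radius i) * cis t) - u (of_real (disk_radius j) * cis t))) < e"
proof -
  note hol = inner_function_holomorphic[OF u]
  obtain N where N: "negligible N"
    "\<And>t. t \<in> {0..2 * pi} - N \<Longrightarrow> \<exists>l. has_radial_limit u l (cis t) \<and> norm l = 1"
    using inner_function_radial_limits[OF u] by metis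
  define f where "f i j t = norm (u (of_real (disk_radius i) * cis t) - u (of_real (disk_radius j) * cis t))" for i j t
  have "\<exists>J. \<forall>i\<ge>J. \<forall>j\<ge>J. integral {0..2 * pi} (f i j) < e"
  proof (rule ccontr)
    assume "\<not> ?thesis"
    then have "\<forall>J. \<exists>i j. J \<le> i \<and> J \<le> j \<and> e \<le> integral {0..2 * pi} (f i j)"
      by (meson not_le)
    then obtain i j where ij: "\<And>J. J \<le> i J" "\<And>J. J \<le> j J" "\<And>J. e \<le> integral {0..2 * pi} (f (i J) (j J))"
      by metis
    have fi: "filterlim i sequentially sequentially" "filterlim j sequentially sequentially"
      using ij(1,2) by (auto intro: filterlim_at_top_mono[OF filterlim_ident] always_eventually)
    have "(\<lambda>J. integral {0..2 * pi} (f (i J) (j J))) \<longlonglongrightarrow> (2 * pi - 0) * 0"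
    proof (rule bounded_convergence_const[OF _ _ N(1)])
      show "continuous_on {0..2 * pi} (f (i J) (j J))" for J
        unfolding f_def using disk_radius by (intro continuous_intros continuous_on_circle_disk[OF hol]) auto
      have "norm (u (of_real (disk_radius k) * cis t)) \<le> 1" for k t
        using inner_function_le_one[OF u, of "of_real (disk_radius k) * cis t"] disk_radius[of k] by (simp add: norm_mult)
      then show "\<bar>f (i J) (j J) t\<bar> \<le> 1 + 1" for J t
        unfolding f_def abs_norm_cancel by (intro order_trans[OF norm_triangle_ineq4] add_mono)
      show "(\<lambda>J. f (i J) (j J) t) \<longlonglongrightarrow> 0" if t: "t \<in> {0..2 * pi} - N" for t
      proof -
        obtain l where "has_radial_limit u l (cis t)" using N(2)[OF t] by blast
        note l = has_radial_limit_LIMSEQ[OF this]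
        show ?thesis
          unfolding f_def using tendsto_norm[OF tendsto_diff[OF filterlim_compose[OF l fi(1)] filterlim_compose[OF l fi(2)]]] by simp
      qed
    qed auto
    then have "e \<le> (2 * pi - 0) * 0"
      by (rule LIMSEQ_le_const) (use ij(3) in auto)
    then show False using e by simp
  qed
  then show thesis using that unfolding f_def by blast
qed

subsection \<open>Composition of inner functions\<close>

lemma holomorphic_on_compose2:
  "g holomorphic_on t \<Longrightarrow> f holomorphic_on s \<Longrightarrow> f ` s \<subseteq> t \<Longrightarrow> (\<lambda>x. g (f x)) holomorphic_on s"
  using holomorphic_on_compose_gen[of f s g t] by (simp add: o_def)

lemma unimodular_eq_cis:
  assumes "norm l = 1"
  obtains t where "t \<in> {0..2 * pi}" "l = cis t"
proof
  show "Arg2pi l \<in> {0..2 * pi}" using Arg2pi[of l] by auto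
  show "l = cis (Arg2pi l)" using Arg2pi[of l] assms by (simp add: cis_conv_exp is_Arg_def)
qed

text \<open>A substitute for Fatou's theorem: by the weak type estimate and Littlewood subordination, the
  dilates \<open>u (r * v z)\<close> approximate \<open>u (v z)\<close> uniformly along all radii outside a small set.\<close>
lemma dilates_uniform_on_radii:
  assumes u: "inner_function u" and v: "v holomorphic_on ball 0 1" "\<And>z. norm z < 1 \<Longrightarrow> norm (v z) < 1"
    and c: "0 < c" and e: "0 < e"
  obtains J where "\<And>j. J \<le> j \<Longrightarrow> \<exists>T. T \<in> lmeasurable \<and> measure lebesgue T \<le> e \<and>
    (\<forall>t\<in>{0..2 * pi} - T. \<forall>r\<in>{0..<1}.
      norm (u (of_real (disk_radius j) * v (of_real r * cis t)) - u (v (of_real r * cis t))) \<le> 2 * c)"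
proof -
  note holu = inner_function_holomorphic[OF u]
  have contu: "continuous_on (ball 0 1) u" using holu by (rule holomorphic_on_imp_continuous_on)
  define K where "K = (1 + norm (v 0)) / (1 - norm (v 0))"
  have K: "0 < K" using v(2)[of 0] unfolding K_def by (intro divide_pos_pos add_pos_nonneg) auto
  define \<delta> where "\<delta> = e * c / (10 * K)"
  have \<delta>: "0 < \<delta>" using e c K by (simp add: \<delta>_def)
  obtain J where J: "\<And>i j. \<lbrakk>J \<le> i; J \<le> j\<rbrakk> \<Longrightarrow>
    integral {0..2 * pi} (\<lambda>t. norm (u (of_real (disk_radius i) * cis t) - u (of_real (disk_radius j) * cis t))) < \<delta>"
    using inner_function_L1_Cauchy[OF u \<delta>] by metis
  define g where "g j z = u (of_real (disk_radius j) * v z)" for j z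
  have dil: "norm (of_real (disk_radius j) * w) < 1" if "norm w \<le> 1" for j and w :: complex
  proof -
    have "disk_radius j * norm w \<le> disk_radius j" using that disk_radius[of j] by (intro mult_left_le) auto
    also have "\<dots> < 1" by (rule disk_radius)
    finally show ?thesis using disk_radius[of j] by (simp add: norm_mult)
  qed
  have holdil: "(\<lambda>w. u (of_real (disk_radius j) * w)) holomorphic_on cball 0 1" for j
    using dil by (intro holomorphic_on_compose2[OF holu] holomorphic_intros) auto
  have "\<exists>T. T \<in> lmeasurable \<and> measure lebesgue T \<le> e \<and>
    (\<forall>t\<in>{0..2 * pi} - T. \<forall>r\<in>{0..<1}. norm (g j (of_real r * cis t) - u (v (of_real r * cis t))) \<le> 2 * c)"
    if j: "J \<le> j" for j
  proof -
    have "\<exists>T. T \<in> lmeasurable \<and> measure lebesgue T \<le> e \<and>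
      (\<forall>t\<in>{0..2 * pi} - T. \<forall>r\<in>{0..<disk_radius k}. norm (g j (of_real r * cis t) - u (v (of_real r * cis t))) \<le> 2 * c)" for k
    proof -
      define R where "R = disk_radius k"
      have R: "0 < R" "R < 1" using disk_radius by (auto simp: R_def)
      have holv: "v holomorphic_on cball 0 R" using holomorphic_on_cball_disk[OF v(1)] R by simp
      have v1: "norm (v z) < 1" if "z \<in> cball 0 R" for z using v(2) that R by simp
      have "compact (v ` cball 0 R)"
        using holv by (intro compact_continuous_image holomorphic_on_imp_continuous_on) auto
      then have "uniformly_continuous_on (v ` cball 0 R \<times> {0..1}) (\<lambda>(w, s). u (of_real s * w))"
      proof (intro compact_uniformly_continuous compact_Times)
        show "continuous_on (v ` cball 0 R \<times> {0..1}) (\<lambda>(w, s). u (of_real s * w))"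
          unfolding split_beta
        proof (intro continuous_on_compose2[OF contu] continuous_intros)
          show "(\<lambda>x. of_real (snd x) * fst x) ` (v ` cball 0 R \<times> {0..1}) \<subseteq> ball 0 1"
          proof clarsimp
            fix z :: complex and s :: real assume "norm z \<le> R" "0 \<le> s" "s \<le> 1"
            then show "norm (of_real s * v z) < 1"
              using v1[of z] mult_left_le_one_le[of "norm (v z)" s] by (simp add: norm_mult)
          qed
        qed
      qed auto
      then obtain d where d: "d > 0" "\<And>x y. \<lbrakk>x \<in> v ` cball 0 R \<times> {0..1}; y \<in> v ` cball 0 R \<times> {0..1}; dist x y < d\<rbrakk>
          \<Longrightarrow> dist ((\<lambda>(w, s). u (of_real s * w)) x) ((\<lambda>(w, s). u (of_real s * w)) y) < c"
        unfolding uniformly_continuous_on_def using c by metis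
      obtain i where i: "J \<le> i" "1 - d < disk_radius i"
      proof -
        have "\<forall>\<^sub>F i in sequentially. 1 - d < disk_radius i \<and> J \<le> i"
          using eventually_disk_radius_gt[of "1 - d"] d(1) by (auto intro: eventually_conj eventually_ge_at_top)
        then show thesis using that eventually_happens'[OF sequentially_bot] by blast
      qed
      have near: "norm (g i z - u (v z)) < c" if z: "z \<in> cball 0 R" for z
      proof -
        have "dist (v z, disk_radius i) (v z, 1) < d"
          using i(2) disk_radius[of i] by (simp add: dist_Pair_Pair dist_real_def)
        then have "dist (u (of_real (disk_radius i) * v z)) (u (of_real 1 * v z)) < c"
          using d(2)[of "(v z, disk_radius i)" "(v z, 1)"] z disk_radius[of i] by simp
        then show ?thesis by (simp add: g_def dist_norm)
      qed
      have holg: "(\<lambda>z. g j z - g i z) holomorphic_on cball 0 R"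
        unfolding g_def using less_imp_le[OF v1]
        by (intro holomorphic_intros holomorphic_on_compose2[OF holdil holv]) auto
      obtain T where T: "T \<in> lmeasurable"
        "measure lebesgue T \<le> 10 / c * integral {0..2 * pi} (\<lambda>s. norm (g j (of_real R * cis s) - g i (of_real R * cis s)))"
        "\<And>t r. \<lbrakk>t \<in> {0..2 * pi}; t \<notin> T; 0 \<le> r; r < R\<rbrakk> \<Longrightarrow> norm (g j (of_real r * cis t) - g i (of_real r * cis t)) \<le> c"
        using radial_maximal_cover[OF holg R(1) c] by blast
      have "integral {0..2 * pi} (\<lambda>s. norm (g j (of_real R * cis s) - g i (of_real R * cis s)))
          \<le> K * integral {0..2 * pi} (\<lambda>s. norm (u (of_real (disk_radius j) * cis s) - u (of_real (disk_radius i) * cis s)))"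
        unfolding g_def K_def
        by (rule Littlewood_subordination_L1[OF _ holv R(1) v1]) (intro holomorphic_intros holdil)
      also have "\<dots> \<le> K * \<delta>" using J[OF j i(1)] K by simp
      finally have "10 / c * integral {0..2 * pi} (\<lambda>s. norm (g j (of_real R * cis s) - g i (of_real R * cis s))) \<le> 10 / c * (K * \<delta>)"
        using c by (intro mult_left_mono) auto
      also have "\<dots> = e" using c K by (simp add: \<delta>_def)
      finally have m: "measure lebesgue T \<le> e" using T(2) by linarith
      have "norm (g j (of_real r * cis t) - u (v (of_real r * cis t))) \<le> 2 * c"
        if "t \<in> {0..2 * pi} - T" "r \<in> {0..<R}" for t r
      proof -
        have "norm (g j (of_real r * cis t) - g i (of_real r * cis t)) \<le> c" using T(3) that by auto
        moreover have "norm (g i (of_real r * cis t) - u (v (of_real r * cis t))) < c"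
          using that by (intro near) (simp add: norm_mult)
        ultimately show ?thesis
          using norm_triangle_ineq[of "g j (of_real r * cis t) - g i (of_real r * cis t)" "g i (of_real r * cis t) - u (v (of_real r * cis t))"]
          by simp
      qed
      then show ?thesis using T(1) m unfolding R_def by blast
    qed
    then obtain T where T: "\<And>k. T k \<in> lmeasurable" "\<And>k. measure lebesgue (T k) \<le> e"
      "\<And>k t r. \<lbrakk>t \<in> {0..2 * pi} - T k; r \<in> {0..<disk_radius k}\<rbrakk>
         \<Longrightarrow> norm (g j (of_real r * cis t) - u (v (of_real r * cis t))) \<le> 2 * c"
      by metis
    obtain U where U: "U \<in> lmeasurable" "measure lebesgue U \<le> e" "{x. \<forall>\<^sub>F k in sequentially. x \<in> T k} \<subseteq> U"
      using eventually_in_sets_cover[OF T(1,2)] .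
    have "norm (g j (of_real r * cis t) - u (v (of_real r * cis t))) \<le> 2 * c"
      if t: "t \<in> {0..2 * pi} - U" "r \<in> {0..<1}" for t r
    proof (rule ccontr)
      assume "\<not> ?thesis"
      then have "t \<in> T k" if "r < disk_radius k" for k using T(3)[of t k r] t that by auto
      moreover have "\<forall>\<^sub>F k in sequentially. r < disk_radius k" using t(2) by (intro eventually_disk_radius_gt) auto
      ultimately have "\<forall>\<^sub>F k in sequentially. t \<in> T k" by (auto elim: eventually_mono)
      then show False using U(3) t(1) by blast
    qed
    then show ?thesis using U by blast
  qed
  then show thesis using that unfolding g_def by blast
qed

text \<open>A quantitative form of Loewner's lemma.\<close>
lemma inner_preimage_small:
  assumes v: "inner_function v" "\<And>z. norm z < 1 \<Longrightarrow> norm (v z) < 1"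
    and E: "compact E" "E \<subseteq> {0..2 * pi}" "measure lebesgue E < \<epsilon>"
  obtains T where "T \<in> lmeasurable" "measure lebesgue T \<le> 16 * pi * \<epsilon> / (1 - norm (v 0))"
    "\<And>t s. \<lbrakk>t \<in> {0..2 * pi}; has_radial_limit v (cis s) (cis t); s \<in> E\<rbrakk> \<Longrightarrow> t \<in> T"
proof -
  note holv = inner_function_holomorphic[OF v(1)]
  obtain Q R where Q: "1 < R" "Q holomorphic_on ball 0 R" "\<And>z. norm z \<le> 1 \<Longrightarrow> 0 \<le> Re (Q z)"
    "\<And>t. t \<in> E \<Longrightarrow> 1 \<le> Re (Q (cis t))" "\<And>z. norm z < 1 \<Longrightarrow> norm (Q z) \<le> 4 * \<epsilon> / (1 - norm z)"
    using harmonic_majorant_of_small_set[OF E] by metis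
  define f where "f k t = Re (Q (v (of_real (disk_radius k) * cis t)))" for k t
  have in_ball: "norm (of_real (disk_radius k) * cis t) < 1" for k t
    using disk_radius[of k] by (simp add: norm_mult)
  have holQv: "(Q \<circ> v) holomorphic_on ball 0 1"
    using v(2) Q(1) by (intro holomorphic_on_compose_gen[OF holv Q(2)]) force
  have cont: "continuous_on A (f k)" for A k
    unfolding f_def using continuous_on_circle_disk[OF holQv] disk_radius by (intro continuous_intros) auto
  have f: "0 \<le> f k t" for k t
    unfolding f_def using v(2)[OF in_ball] by (intro Q(3) less_imp_le)
  have If: "integral {0..2 * pi} (f k) / (1 / 2) \<le> 16 * pi * \<epsilon> / (1 - norm (v 0))" for k
  proof -
    have "integral {0..2 * pi} (f k) = Re (of_real (2 * pi) * (Q \<circ> v) 0)"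
      using integral_unique[OF has_integral_Re[OF circle_mean[OF holomorphic_on_cball_disk[OF holQv]]], of "disk_radius k"]
        disk_radius[of k] by (simp add: f_def[abs_def])
    also have "\<dots> \<le> norm (of_real (2 * pi) * (Q \<circ> v) 0)" by (rule complex_Re_le_cmod)
    also have "\<dots> = 2 * pi * norm (Q (v 0))" by (simp add: norm_mult)
    also have "\<dots> \<le> 2 * pi * (4 * \<epsilon> / (1 - norm (v 0)))" using v(2) by (intro mult_left_mono Q(5)) auto
    finally show ?thesis by simp
  qed
  define S where "S k = {t \<in> {0..2 * pi}. 1 / 2 \<le> f k t}" for k
  have S: "S k \<in> lmeasurable" "measure lebesgue (S k) \<le> 16 * pi * \<epsilon> / (1 - norm (v 0))" for k
    unfolding S_def
    by (rule lmeasurable_compact[OF Markov_superlevel(1)[OF cont f]], simp,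
        rule order_trans[OF Markov_superlevel(2)[OF cont f] If], simp)
  obtain T where T: "T \<in> lmeasurable" "measure lebesgue T \<le> 16 * pi * \<epsilon> / (1 - norm (v 0))"
    "{x. \<forall>\<^sub>F k in sequentially. x \<in> S k} \<subseteq> T"
    using eventually_in_sets_cover[OF S] .
  have "t \<in> T" if t: "t \<in> {0..2 * pi}" "has_radial_limit v (cis s) (cis t)" "s \<in> E" for t s
  proof -
    have "isCont Q (cis s)"
      using holomorphic_on_imp_continuous_on[OF Q(2)] Q(1) by (auto simp: continuous_on_eq_continuous_at)
    then have "(\<lambda>k. f k t) \<longlonglongrightarrow> Re (Q (cis s))"
      unfolding f_def by (intro tendsto_Re isCont_tendsto_compose[OF _ has_radial_limit_LIMSEQ[OF t(2)]])
    then have "\<forall>\<^sub>F k in sequentially. 1 / 2 < f k t"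
      using Q(4)[OF t(3)] by (intro order_tendstoD(1)) auto
    then have "\<forall>\<^sub>F k in sequentially. t \<in> S k"
      by eventually_elim (use t(1) in \<open>simp add: S_def\<close>)
    then show ?thesis using T(3) by blast
  qed
  then show thesis using that T by blast
qed

lemma inner_compose_radial_oscillation:
  assumes u: "inner_function u" and v: "inner_function v" "\<And>z. norm z < 1 \<Longrightarrow> norm (v z) < 1"
    and c: "0 < c"
  defines "P \<equiv> (\<lambda>t. \<exists>r0\<in>{0..<1}. \<forall>r\<in>{r0..<1}. 1 - 4 * c \<le> norm (u (v (of_real r * cis t))) \<and>
      (\<forall>r'\<in>{r0..<1}. norm (u (v (of_real r * cis t)) - u (v (of_real r' * cis t))) \<le> 6 * c))"
  shows "negligible {t \<in> {0..2 * pi}. \<not> P t}"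
  unfolding negligible_outer_le
proof (intro allI impI)
  fix e :: real assume e: "0 < e"
  note holu = inner_function_holomorphic[OF u]
  have v0: "norm (v 0) < 1" using v(2) by simp
  obtain N where N: "negligible N"
    "\<And>t. t \<in> {0..2 * pi} - N \<Longrightarrow> \<exists>l. has_radial_limit v l (cis t) \<and> norm l = 1"
    using inner_function_radial_limits[OF v(1)] by metis
  obtain J where J: "\<And>j. J \<le> j \<Longrightarrow> \<exists>T. T \<in> lmeasurable \<and> measure lebesgue T \<le> e / 2 \<and>
    (\<forall>t\<in>{0..2 * pi} - T. \<forall>r\<in>{0..<1}.
      norm (u (of_real (disk_radius j) * v (of_real r * cis t)) - u (v (of_real r * cis t))) \<le> 2 * c)"
    using dilates_uniform_on_radii[OF u inner_function_holomorphic[OF v(1)] v(2) c half_gt_zero[OF e]] by blast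
  define \<epsilon> where "\<epsilon> = e * (1 - norm (v 0)) / (32 * pi)"
  have \<epsilon>: "0 < \<epsilon>" using e v0 by (simp add: \<epsilon>_def)
  have "1 - c < 1" using c by simp
  note small = inner_function_small_values[OF u this]
  have "\<forall>\<^sub>F j in sequentially. J \<le> j \<and>
      measure lebesgue {t \<in> {0..2 * pi}. norm (u (of_real (disk_radius j) * cis t)) \<le> 1 - c} < \<epsilon>"
    using order_tendstoD(2)[OF small(2) \<epsilon>] by (auto intro: eventually_conj eventually_ge_at_top)
  then obtain j where j: "J \<le> j"
      "measure lebesgue {t \<in> {0..2 * pi}. norm (u (of_real (disk_radius j) * cis t)) \<le> 1 - c} < \<epsilon>"
    using eventually_happens'[OF sequentially_bot] by blast
  define E where "E = {t \<in> {0..2 * pi}. norm (u (of_real (disk_radius j) * cis t)) \<le> 1 - c}"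
  have E: "compact E" "E \<subseteq> {0..2 * pi}" "measure lebesgue E < \<epsilon>"
    unfolding E_def using small(1)[of j] j(2) by blast+
  obtain T1 where T1: "T1 \<in> lmeasurable" "measure lebesgue T1 \<le> e / 2"
    "\<And>t r. \<lbrakk>t \<in> {0..2 * pi} - T1; r \<in> {0..<1}\<rbrakk> \<Longrightarrow>
      norm (u (of_real (disk_radius j) * v (of_real r * cis t)) - u (v (of_real r * cis t))) \<le> 2 * c"
    using J[OF j(1)] by blast
  obtain T2 where T2: "T2 \<in> lmeasurable" "measure lebesgue T2 \<le> 16 * pi * \<epsilon> / (1 - norm (v 0))"
    "\<And>t s. \<lbrakk>t \<in> {0..2 * pi}; has_radial_limit v (cis s) (cis t); s \<in> E\<rbrakk> \<Longrightarrow> t \<in> T2"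
    using inner_preimage_small[OF v E] by metis
  have mT2: "measure lebesgue T2 \<le> e / 2" 
  proof -
    have "16 * pi * (e * q / (32 * pi)) / q = e / 2" if "0 < q" for q
      using that by (simp add: field_simps)
    then show ?thesis using T2(2) v0 by (simp only: \<epsilon>_def)
  qed
  have N': "N \<in> lmeasurable" "measure lebesgue N = 0"
    using N(1) by (auto simp: negligible_iff_measure)
  have T: "T1 \<union> T2 \<union> N \<in> lmeasurable" using T1 T2 N' by (intro fmeasurable.Un)
  have "measure lebesgue (T1 \<union> T2 \<union> N) \<le> measure lebesgue (T1 \<union> T2) + measure lebesgue N"
    using T1 T2 N' by (intro measure_Un_le) (auto intro: fmeasurableD)
  also have "measure lebesgue (T1 \<union> T2) \<le> measure lebesgue T1 + measure lebesgue T2"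
    using T1 T2 by (intro measure_Un_le) (auto intro: fmeasurableD)
  finally have m: "measure lebesgue (T1 \<union> T2 \<union> N) \<le> e" using T1(2) mT2 N'(2) by simp
  have "P t" if t: "t \<in> {0..2 * pi}" "t \<notin> T1 \<union> T2 \<union> N" for t
  proof -
    obtain l where l: "has_radial_limit v l (cis t)" "norm l = 1" using N(2)[of t] t by auto
    obtain s where s: "s \<in> {0..2 * pi}" "l = cis s" using unimodular_eq_cis[OF l(2)] .
    have "s \<notin> E" using T2(3)[of t s] l(1) s(2) t by auto
    then have big: "1 - c < norm (u (of_real (disk_radius j) * l))" using s by (auto simp: E_def)
    define g where "g r = u (of_real (disk_radius j) * v (of_real r * cis t))" for r
    define f where "f r = u (v (of_real r * cis t))" for r
    have "norm (of_real (disk_radius j) * l) < 1" using disk_radius[of j] l(2) by (simp add: norm_mult)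
    then have "isCont u (of_real (disk_radius j) * l)"
      using holomorphic_on_imp_continuous_on[OF holu] by (auto simp: continuous_on_eq_continuous_at)
    then have "(g \<longlongrightarrow> u (of_real (disk_radius j) * l)) (at_left 1)"
      unfolding g_def
      by (rule isCont_tendsto_compose) (use l(1) in \<open>auto simp: has_radial_limit_def intro!: tendsto_intros\<close>)
    then have "\<forall>\<^sub>F r in at_left 1. dist (g r) (u (of_real (disk_radius j) * l)) < c" using c by (rule tendstoD)
    then obtain b where b: "b < 1" "\<And>r. \<lbrakk>b < r; r < 1\<rbrakk> \<Longrightarrow> dist (g r) (u (of_real (disk_radius j) * l)) < c"
      unfolding eventually_at_left_field by blast
    define r0 where "r0 = max 0 ((1 + b) / 2)"
    have r0: "r0 \<in> {0..<1}" "b < r0" using b(1) by (auto simp: r0_def less_max_iff_disj)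
    have near: "norm (f r - u (of_real (disk_radius j) * l)) \<le> 3 * c" if "r \<in> {r0..<1}" for r
    proof -
      have "norm (g r - f r) \<le> 2 * c" unfolding g_def f_def using T1(3)[of t r] t that r0 by auto
      moreover have "norm (g r - u (of_real (disk_radius j) * l)) < c" using b(2)[of r] that r0 by (auto simp: dist_norm)
      ultimately show ?thesis
        using norm_triangle_ineq4[of "g r - u (of_real (disk_radius j) * l)" "g r - f r"] by (simp add: algebra_simps)
    qed
    show "P t"
      unfolding P_def
    proof (intro bexI[OF _ r0(1)] ballI conjI)
      fix r assume r: "r \<in> {r0..<1}"
      show "1 - 4 * c \<le> norm (u (v (of_real r * cis t)))"
        using near[OF r] big norm_triangle_ineq2[of "u (of_real (disk_radius j) * l)" "u (of_real (disk_radius j) * l) - f r"]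
        by (simp add: f_def norm_minus_commute)
      fix r' assume r': "r' \<in> {r0..<1}"
      show "norm (u (v (of_real r * cis t)) - u (v (of_real r' * cis t))) \<le> 6 * c"
        using near[OF r] near[OF r'] norm_triangle_ineq4[of "f r - u (of_real (disk_radius j) * l)" "f r' - u (of_real (disk_radius j) * l)"]
        by (simp add: f_def)
    qed
  qed
  then have "{t \<in> {0..2 * pi}. \<not> P t} \<subseteq> T1 \<union> T2 \<union> N" by blast
  then show "\<exists>T. {t \<in> {0..2 * pi}. \<not> P t} \<subseteq> T \<and> T \<in> lmeasurable \<and> measure lebesgue T \<le> e"
    using T m by blast
qed

lemma unimodular_limit_if_small_oscillation:
  fixes f :: "real \<Rightarrow> complex"
  assumes f1: "\<And>r. \<lbrakk>0 \<le> r; r < 1\<rbrakk> \<Longrightarrow> norm (f r) \<le> 1"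
    and osc: "\<And>c. 0 < c \<Longrightarrow> \<exists>r0\<in>{0..<1}. \<forall>r\<in>{r0..<1}. 1 - c \<le> norm (f r) \<and> (\<forall>r'\<in>{r0..<1}. norm (f r - f r') \<le> c)"
  shows "\<exists>l. (f \<longlongrightarrow> l) (at_left 1) \<and> norm l = 1"
proof -
  have ev: "\<forall>\<^sub>F k in sequentially. disk_radius k \<in> {r0..<1}" if "r0 < 1" for r0
    using eventually_disk_radius_gt[OF that] by eventually_elim (use disk_radius in \<open>auto intro: less_imp_le\<close>)
  have "Cauchy (\<lambda>k. f (disk_radius k))"
    unfolding Cauchy_def
  proof (intro allI impI)
    fix e :: real assume "0 < e"
    then obtain r0 where r0: "r0 < 1" "\<And>r r'. \<lbrakk>r \<in> {r0..<1}; r' \<in> {r0..<1}\<rbrakk> \<Longrightarrow> norm (f r - f r') \<le> e / 2"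
      using osc[of "e / 2"] by force
    obtain M where "\<And>k. M \<le> k \<Longrightarrow> disk_radius k \<in> {r0..<1}"
      using ev[OF r0(1)] unfolding eventually_sequentially by blast
    then have "dist (f (disk_radius m)) (f (disk_radius n)) < e" if "M \<le> m" "M \<le> n" for m n
      using r0(2)[of "disk_radius m" "disk_radius n"] that \<open>0 < e\<close> by (simp add: dist_norm)
    then show "\<exists>M. \<forall>m\<ge>M. \<forall>n\<ge>M. dist (f (disk_radius m)) (f (disk_radius n)) < e" by blast
  qed
  then obtain l where l: "(\<lambda>k. f (disk_radius k)) \<longlonglongrightarrow> l"
    using Cauchy_convergent convergent_def by blast
  have "(f \<longlongrightarrow> l) (at_left 1)"
  proof (rule tendstoI)
    fix e :: real assume "0 < e"
    then obtain r0 where r0: "r0 < 1" "\<And>r r'. \<lbrakk>r \<in> {r0..<1}; r' \<in> {r0..<1}\<rbrakk> \<Longrightarrow> norm (f r - f r') \<le> e / 2"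
      using osc[of "e / 2"] by force
    have "dist (f r) l < e" if r: "r \<in> {r0..<1}" for r
    proof -
      have "norm (f r - l) \<le> e / 2"
      proof (rule Lim_norm_ubound)
        show "(\<lambda>k. f r - f (disk_radius k)) \<longlonglongrightarrow> f r - l" by (intro tendsto_intros l)
        show "\<forall>\<^sub>F k in sequentially. norm (f r - f (disk_radius k)) \<le> e / 2"
          using ev[OF r0(1)] by eventually_elim (use r0(2)[OF r] in auto)
      qed simp
      then show ?thesis using \<open>0 < e\<close> by (simp add: dist_norm)
    qed
    then show "\<forall>\<^sub>F r in at_left 1. dist (f r) l < e"
      unfolding eventually_at_left_field using r0(1) by auto
  qed
  moreover have "norm l \<le> 1"
    by (rule Lim_norm_ubound[OF _ l]) (use f1 disk_radius in auto)
  moreover have "1 \<le> norm l"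
  proof (rule field_le_epsilon)
    fix e :: real assume "0 < e"
    then obtain r0 where r0: "r0 < 1" "\<And>r. r \<in> {r0..<1} \<Longrightarrow> 1 - e \<le> norm (f r)"
      using osc[of e] by force
    have "1 - e \<le> norm l"
    proof (rule tendsto_lowerbound[OF tendsto_norm[OF l]])
      show "\<forall>\<^sub>F k in sequentially. 1 - e \<le> norm (f (disk_radius k))"
        using ev[OF r0(1)] by eventually_elim (rule r0(2))
    qed simp
    then show "1 \<le> norm l + e" by simp
  qed
  ultimately show ?thesis by (intro exI[of _ l]) auto
qed

lemma inner_function_compose:
  assumes u: "inner_function u" and v: "inner_function v" "\<not> v constant_on ball 0 1"
  shows "inner_function (u \<circ> v)"
proof -
  have v1: "norm (v z) < 1" if "norm z < 1" for z using inner_function_less_one[OF v that] .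
  define P where "P c t \<longleftrightarrow> (\<exists>r0\<in>{0..<1}. \<forall>r\<in>{r0..<1}. 1 - 4 * c \<le> norm (u (v (of_real r * cis t))) \<and>
      (\<forall>r'\<in>{r0..<1}. norm (u (v (of_real r * cis t)) - u (v (of_real r' * cis t))) \<le> 6 * c))" for c t
  define N where "N = (\<Union>n. {t \<in> {0..2 * pi}. \<not> P (inverse (real (Suc n))) t})"
  have N: "negligible N"
    unfolding N_def P_def
    by (intro negligible_Union_nat inner_compose_radial_oscillation[OF u v(1) v1]) auto
  have lim: "\<exists>l. has_radial_limit (u \<circ> v) l (cis t) \<and> norm l = 1" if t: "t \<in> {0..2 * pi}" "t \<notin> N" for t
    unfolding has_radial_limit_def comp_def
  proof (rule unimodular_limit_if_small_oscillation)
    show "norm (u (v (of_real r * cis t))) \<le> 1" if "0 \<le> r" "r < 1" for r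
      using inner_function_le_one[OF u v1] that by (simp add: norm_mult)
    fix c :: real assume "0 < c"
    then obtain n where n: "inverse (real (Suc n)) < c / 6" using reals_Archimedean[of "c / 6"] by auto
    define d where "d = inverse (real (Suc n))"
    have d: "0 < d" "6 * d < c" using n by (auto simp: d_def)
    have "P d t" using t by (auto simp: N_def d_def)
    then obtain r0 where r0: "r0 \<in> {0..<1}" "\<And>r. r \<in> {r0..<1} \<Longrightarrow> 1 - 4 * d \<le> norm (u (v (of_real r * cis t)))"
      "\<And>r r'. \<lbrakk>r \<in> {r0..<1}; r' \<in> {r0..<1}\<rbrakk> \<Longrightarrow> norm (u (v (of_real r * cis t)) - u (v (of_real r' * cis t))) \<le> 6 * d"
      unfolding P_def by blast
    show "\<exists>r0\<in>{0..<1}. \<forall>r\<in>{r0..<1}. 1 - c \<le> norm (u (v (of_real r * cis t))) \<and>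
      (\<forall>r'\<in>{r0..<1}. norm (u (v (of_real r * cis t)) - u (v (of_real r' * cis t))) \<le> c)"
    proof (intro bexI[OF _ r0(1)] ballI conjI)
      fix r assume r: "r \<in> {r0..<1}"
      show "1 - c \<le> norm (u (v (of_real r * cis t)))" using r0(2)[OF r] d by linarith
      show "norm (u (v (of_real r * cis t)) - u (v (of_real r' * cis t))) \<le> c" if "r' \<in> {r0..<1}" for r'
        using r0(3)[OF r that] d by linarith
    qed
  qed
  have "negligible {t \<in> {0..2 * pi}. \<not> (\<exists>l. has_radial_limit (u \<circ> v) l (cis t) \<and> norm l = 1)}"
    by (rule negligible_subset[OF N]) (use lim in blast)
  then have "AE t in lebesgue_on {0..2 * pi}. \<exists>l. has_radial_limit (u \<circ> v) l (cis t) \<and> norm l = 1"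
    by (subst AE_lebesgue_on_iff_negligible) auto
  moreover have "(u \<circ> v) holomorphic_on ball 0 1"
    using v1 inner_function_holomorphic[OF v(1)] inner_function_holomorphic[OF u]
    by (intro holomorphic_on_compose_gen) auto
  moreover have "bounded ((u \<circ> v) ` ball 0 1)"
    unfolding bounded_iff using inner_function_le_one[OF u v1] by (intro exI[of _ 1]) auto
  ultimately show ?thesis by (simp add: inner_function_def H_infinity_def)
qed

subsection \<open>Connectedness of preimages\<close>

text \<open>Frontier points on the circle of radius \<open>disk_radius k\<close> are compensated by a factor
  \<open>exp (- L * Q)\<close>, where \<open>Re Q\<close> majorizes the indicator of the small set of angles at which
  \<open>norm v \<le> \<kappa>\<close>.\<close>
lemma maximum_principle_off_small_values:
  assumes v: "inner_function v" and \<kappa>: "\<kappa> < 1"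
    and U: "open U" "U \<subseteq> ball 0 1" "\<And>z. z \<in> U \<Longrightarrow> norm (v z) \<le> \<kappa>"
    and g: "g holomorphic_on U" "continuous_on (closure U \<inter> ball 0 1) g"
    and B: "\<And>z. z \<in> U \<Longrightarrow> norm (g z) \<le> B"
    and fr: "\<And>z. z \<in> frontier U \<inter> ball 0 1 \<Longrightarrow> norm (g z) \<le> 1"
    and z: "z \<in> U"
  shows "norm (g z) \<le> 1"
proof (rule ccontr)
  assume gz: "\<not> ?thesis"
  have z1: "norm z < 1" using z U by auto
  have contv: "continuous_on (ball 0 1) v"
    using inner_function_holomorphic[OF v] by (rule holomorphic_on_imp_continuous_on)
  define B' where "B' = max B 2"
  define L where "L = ln B'"
  have L: "0 < L" "exp L = B'" by (auto simp: L_def B'_def)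
  have clB: "norm (g w) \<le> B'" if "w \<in> closure U \<inter> ball 0 1" for w
  proof (cases "w \<in> U")
    case True
    then show ?thesis using B[of w] by (simp add: B'_def)
  next
    case False
    then have "w \<in> frontier U" using that U(1) by (simp add: frontier_def interior_open)
    then show ?thesis using fr[of w] that by (simp add: B'_def)
  qed
  have clv: "norm (v w) \<le> \<kappa>" if w: "w \<in> closure U \<inter> ball 0 1" for w
  proof -
    obtain x where x: "\<And>n. x n \<in> U" "x \<longlonglongrightarrow> w" using w by (auto simp: closure_sequential)
    have "isCont v w" using contv w by (auto simp: continuous_on_eq_continuous_at)
    then have "(\<lambda>n. v (x n)) \<longlonglongrightarrow> v w" using x(2) by (rule isCont_tendsto_compose)
    then show ?thesis by (rule Lim_norm_ubound[rotated]) (use U(3) x(1) in auto)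
  qed
  define \<mu> where "\<mu> = ln (norm (g z))"
  have \<mu>: "0 < \<mu>" unfolding \<mu>_def using gz by (intro ln_gt_zero) simp
  define \<epsilon> where "\<epsilon> = \<mu> * (1 - norm z) / (16 * L)"
  have \<epsilon>: "0 < \<epsilon>" using \<mu> L z1 by (simp add: \<epsilon>_def)
  note small = inner_function_small_values[OF v \<kappa>]
  have "\<forall>\<^sub>F k in sequentially. (1 + norm z) / 2 < disk_radius k \<and>
      measure lebesgue {t \<in> {0..2 * pi}. norm (v (of_real (disk_radius k) * cis t)) \<le> \<kappa>} < \<epsilon>"
    using order_tendstoD(2)[OF small(2) \<epsilon>] eventually_disk_radius_gt[of "(1 + norm z) / 2"] z1
    by (auto intro: eventually_conj)
  then obtain k where k: "(1 + norm z) / 2 < disk_radius k"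
      "measure lebesgue {t \<in> {0..2 * pi}. norm (v (of_real (disk_radius k) * cis t)) \<le> \<kappa>} < \<epsilon>"
    using eventually_happens'[OF sequentially_bot] by blast
  define R where "R = disk_radius k"
  have R: "0 < R" "R < 1" using disk_radius by (auto simp: R_def)
  define E where "E = {t \<in> {0..2 * pi}. norm (v (of_real R * cis t)) \<le> \<kappa>}"
  have E: "compact E" "E \<subseteq> {0..2 * pi}" "measure lebesgue E < \<epsilon>"
    unfolding E_def R_def using small(1)[of k] k(2) by blast+
  obtain Q R' where Q: "1 < R'" "Q holomorphic_on ball 0 R'" "\<And>z. norm z \<le> 1 \<Longrightarrow> 0 \<le> Re (Q z)"
    "\<And>t. t \<in> E \<Longrightarrow> 1 \<le> Re (Q (cis t))" "\<And>z. norm z < 1 \<Longrightarrow> norm (Q z) \<le> 4 * \<epsilon> / (1 - norm z)"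
    using harmonic_majorant_of_small_set[OF E] by metis
  define S where "S = {w \<in> ball 0 1. of_real R * w \<in> U}"
  define h where "h w = g (of_real R * w) * exp (- of_real L * Q w)" for w
  have contm: "continuous_on A (\<lambda>w. of_real R * w)" for A :: "complex set" by (intro continuous_intros)
  have S: "open S"
  proof -
    have "S = ball 0 1 \<inter> (\<lambda>w. of_real R * w) -` U" by (auto simp: S_def)
    then show ?thesis using open_vimage[OF U(1) contm] by (simp add: open_Int)
  qed
  have clS: "norm w \<le> 1" "of_real R * w \<in> closure U \<inter> ball 0 1" if w: "w \<in> closure S" for w
  proof -
    have "closure S \<subseteq> cball 0 1" by (rule closure_minimal) (auto simp: S_def)
    then show w1: "norm w \<le> 1" using w by auto
    have "norm (of_real R * w) = R * norm w" using R by (simp add: norm_mult)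
    also have "\<dots> \<le> R" using R w1 by (intro mult_left_le) auto
    finally have "norm (of_real R * w) < 1" using R(2) by linarith
    moreover have "(\<lambda>w. of_real R * w) ` closure S \<subseteq> closure U"
      by (rule image_closure_subset[OF contm]) (auto simp: S_def intro: closure_subset[THEN subsetD])
    ultimately show "of_real R * w \<in> closure U \<inter> ball 0 1" using w by auto
  qed
  have z': "z / of_real R \<in> S" using z k z1 R by (auto simp: S_def norm_divide R_def[symmetric])
  have "norm (h (z / of_real R)) \<le> 1"
  proof (rule maximum_modulus_frontier[OF _ _ _ _ z'])
    show "h holomorphic_on interior S"
      unfolding h_def interior_open[OF S] using Q(1)
      by (intro holomorphic_intros holomorphic_on_compose2[OF g(1)] holomorphic_on_subset[OF Q(2)]) (auto simp: S_def)
    show "continuous_on (closure S) h"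
      unfolding h_def using Q(1) clS
      by (intro continuous_intros continuous_on_compose2[OF g(2)]
            continuous_on_subset[OF holomorphic_on_imp_continuous_on[OF Q(2)]]) force+
    show "bounded S" by (rule bounded_subset[of "ball 0 1"]) (auto simp: S_def)
    show "norm (h w) \<le> 1" if w: "w \<in> frontier S" for w
    proof -
      have wS: "w \<in> closure S" "w \<notin> S" using w S by (auto simp: frontier_def interior_open)
      have nh: "norm (h w) = norm (g (of_real R * w)) * exp (- L * Re (Q w))"
        by (simp add: h_def norm_mult)
      have ReQ: "0 \<le> Re (Q w)" using Q(3) clS(1)[OF wS(1)] by simp
      show ?thesis
      proof (cases "norm w < 1")
        case True
        then have "of_real R * w \<notin> U" using wS(2) by (simp add: S_def)
        then have "of_real R * w \<in> frontier U \<inter> ball 0 1"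
          using clS(2)[OF wS(1)] U(1) by (simp add: frontier_def interior_open)
        then have "norm (g (of_real R * w)) \<le> 1" by (rule fr)
        moreover have "exp (- L * Re (Q w)) \<le> 1" using L ReQ by simp
        ultimately show ?thesis unfolding nh by (intro mult_le_one) auto
      next
        case False
        then have "norm w = 1" using clS(1)[OF wS(1)] by simp
        then obtain t where t: "t \<in> {0..2 * pi}" "w = cis t" by (rule unimodular_eq_cis)
        then have "t \<in> E" using clv[OF clS(2)[OF wS(1)]] by (simp add: E_def)
        then have "1 \<le> Re (Q w)" using Q(4) t by simp
        then have "exp (- L * Re (Q w)) \<le> exp (- L)" using L by simp
        then have "norm (h w) \<le> B' * exp (- L)"
          unfolding nh using clB[OF clS(2)[OF wS(1)]] L by (intro mult_mono) (auto simp: B'_def)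
        also have "\<dots> = 1" by (simp add: L(2)[symmetric] exp_minus)
        finally show ?thesis .
      qed
    qed
  qed
  then have "norm (g z) * exp (- L * Re (Q (z / of_real R))) \<le> 1" using R by (simp add: h_def norm_mult)
  then have "norm (g z) \<le> exp (L * Re (Q (z / of_real R)))"
    by (simp add: exp_minus field_simps)
  moreover have "0 < norm (g z)" using gz by linarith
  ultimately have "\<mu> \<le> L * Re (Q (z / of_real R))" by (metis \<mu>_def ln_exp ln_mono)
  also have "\<dots> \<le> L * (8 * \<epsilon> / (1 - norm z))"
  proof -
    define x where "x = norm (z / of_real R)"
    have Rz: "(1 + norm z) / 2 < R" using k(1) by (simp add: R_def)
    have "norm z / R \<le> norm z / ((1 + norm z) / 2)"
      using Rz R z1 by (intro divide_left_mono mult_pos_pos add_pos_nonneg divide_pos_pos) auto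
    also have "\<dots> \<le> (1 + norm z) / 2"
    proof -
      have "4 * norm z \<le> (1 + norm z) * (1 + norm z)"
        using zero_le_power2[of "1 - norm z"] by (simp add: power2_eq_square algebra_simps)
      moreover have "0 < 1 + norm z" by (simp add: add_pos_nonneg)
      ultimately show ?thesis by (simp add: field_simps)
    qed
    finally have x: "x \<le> (1 + norm z) / 2" using R by (simp add: x_def norm_divide)
    have "Re (Q (z / of_real R)) \<le> 4 * \<epsilon> / (1 - x)"
      unfolding x_def using x z1 by (intro order_trans[OF complex_Re_le_cmod] Q(5)) (simp add: x_def)
    also have "\<dots> \<le> 4 * \<epsilon> / ((1 - norm z) / 2)"
      using x z1 \<epsilon> by (intro divide_left_mono mult_pos_pos) (auto simp: field_simps)
    finally show ?thesis using L by (intro mult_left_mono) auto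
  qed
  also have "\<dots> = \<mu> / 2" using L z1 by (simp add: \<epsilon>_def field_simps)
  finally show False using \<mu> by simp
qed

text \<open>If the image of \<open>C\<close> missed \<open>A\<close>, the function \<open>\<rho> / (v - w1)\<close> with \<open>w1\<close> outside but close to
  the image of \<open>C\<close> would violate the maximum principle.\<close>
lemma inner_component_image_meets:
  assumes v: "inner_function v" "\<And>z. norm z < 1 \<Longrightarrow> norm (v z) < 1"
    and D: "open D" "connected D" "D \<subseteq> ball 0 1" and A: "open A" "A \<subseteq> D" "A \<noteq> {}"
    and C: "C \<in> components {z \<in> ball 0 1. v z \<in> D}"
  shows "v ` C \<inter> A \<noteq> {}"
proof
  assume miss: "v ` C \<inter> A = {}"
  define W where "W = {z \<in> ball 0 1. v z \<in> D}"
  have contv: "continuous_on (ball 0 1) v"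
    using inner_function_holomorphic[OF v(1)] by (rule holomorphic_on_imp_continuous_on)
  have W: "open W"
    using continuous_open_preimage[OF contv open_ball D(1)] by (simp add: W_def vimage_def Int_def)
  have CW: "C \<subseteq> W" "C \<noteq> {}" "open C" "connected C"
    using C open_components[OF W] in_components_subset in_components_nonempty in_components_connected
    unfolding W_def by blast+
  have vC: "v ` C \<subseteq> D" using CW(1) by (auto simp: W_def)
  have clA: "A \<inter> closure (v ` C) = {}"
    using miss A(1) by (simp add: open_Int_closure_eq_empty Int_commute)
  define X where "X = D \<inter> closure (v ` C)"
  have "X \<noteq> {}" using CW(2) vC closure_subset[of "v ` C"] by (auto simp: X_def)
  moreover have "X \<noteq> D" using clA A by (auto simp: X_def)
  moreover have "closedin (top_of_set D) X" unfolding X_def by (simp add: closedin_closed_Int)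
  ultimately have "\<not> openin (top_of_set D) X" using D(2) by (auto simp: connected_clopen)
  then have "\<not> open X" using openin_open_eq[OF D(1)] by (auto simp: X_def)
  then obtain w0 where w0: "w0 \<in> X" "\<And>d. 0 < d \<Longrightarrow> \<not> ball w0 d \<subseteq> X"
    unfolding open_contains_ball by blast
  have "w0 \<in> D" using w0 by (simp add: X_def)
  then obtain d0 where d0: "0 < d0" "ball w0 d0 \<subseteq> D" using D(1) open_contains_ball by blast
  have w01: "norm w0 < 1" using \<open>w0 \<in> D\<close> D(3) by auto
  define d where "d = min (d0 / 4) ((1 - norm w0) / 4)"
  have d: "0 < d" "4 * d \<le> d0" "norm w0 + 4 * d \<le> 1"
    using d0 w01 min.cobounded2[of "d0 / 4" "(1 - norm w0) / 4"] by (auto simp: d_def)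
  obtain w1 where w1: "w1 \<in> ball w0 d" "w1 \<notin> X" using w0(2)[OF d(1)] by blast
  have "w1 \<in> D" using w1(1) d d0(2) by auto
  then have "w1 \<notin> closure (v ` C)" using w1(2) by (simp add: X_def)
  then obtain s where s: "0 < s" "ball w1 s \<subseteq> - closure (v ` C)"
    using openE[of "- closure (v ` C)" w1] by auto
  then have sC: "ball w1 s \<inter> v ` C = {}" using closure_subset[of "v ` C"] by blast
  have "w0 \<in> closure (v ` C)" using w0(1) by (simp add: X_def)
  then obtain z2 where z2: "z2 \<in> C" "dist (v z2) w0 < d"
    using d(1) unfolding closure_approachable by blast
  define \<rho> where "\<rho> = 2 * d"
  have \<rho>: "0 < \<rho>" using d by (simp add: \<rho>_def)
  have near: "dist (v z2) w1 < \<rho>"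
    using z2(2) w1(1) dist_triangle[of "v z2" w1 w0] by (simp add: \<rho>_def dist_commute)
  have ballD: "cball w1 \<rho> \<subseteq> D"
  proof
    fix x assume "x \<in> cball w1 \<rho>"
    then have "dist w0 x < 4 * d" using w1(1) dist_triangle[of w0 x w1] d(1) by (simp add: \<rho>_def)
    then show "x \<in> D" using d d0(2) by auto
  qed
  define U where "U = {z \<in> C. dist (v z) w1 < \<rho>}"
  define g where "g z = of_real \<rho> / (v z - w1)" for z
  have C1: "C \<subseteq> ball 0 1" using CW(1) by (auto simp: W_def)
  have far: "s \<le> norm (v z - w1)" if "z \<in> C" for z
    proof (rule ccontr)
    assume "\<not> ?thesis"
    then have "v z \<in> ball w1 s" by (simp add: dist_norm norm_minus_commute)
    then show False using sC that by blast
  qed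
  have U: "open U"
  proof -
    have "open (C \<inter> v -` ball w1 \<rho>)"
      using continuous_open_preimage[OF continuous_on_subset[OF contv C1] CW(3) open_ball] .
    moreover have "C \<inter> v -` ball w1 \<rho> = U" by (auto simp: U_def dist_commute)
    ultimately show ?thesis by simp
  qed
  have UC: "U \<subseteq> C" by (auto simp: U_def)
  have clU: "z \<in> C \<and> dist (v z) w1 \<le> \<rho>" if z: "z \<in> closure U \<inter> ball 0 1" for z
  proof -
    obtain x where x: "\<And>n. x n \<in> U" "x \<longlonglongrightarrow> z" using z by (auto simp: closure_sequential)
    have "isCont v z" using contv z by (auto simp: continuous_on_eq_continuous_at)
    then have "(\<lambda>n. v (x n)) \<longlonglongrightarrow> v z" using x(2) by (rule isCont_tendsto_compose)
    then have "(\<lambda>n. dist (v (x n)) w1) \<longlonglongrightarrow> dist (v z) w1" by (intro tendsto_intros)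
    then have le: "dist (v z) w1 \<le> \<rho>"
      by (rule LIMSEQ_le_const2) (use x(1) in \<open>auto simp: U_def intro: less_imp_le\<close>)
    then have "z \<in> W" using z ballD by (auto simp: W_def dist_commute)
    moreover have "z \<in> closure C" using z closure_mono[OF UC] by blast
    ultimately have "z \<in> C"
    proof -
      assume zW: "z \<in> W"
      have "connected (insert z C)"
        using connected_intermediate_closure[OF CW(4), of "insert z C"] \<open>z \<in> closure C\<close> closure_subset[of C] by auto
      moreover have "insert z C \<subseteq> W" using zW CW(1) by auto
      ultimately have "insert z C \<subseteq> C"
        using components_maximal[OF C[folded W_def], of "insert z C"] CW(2) by auto
      then show ?thesis by simp
    qed
    then show ?thesis using le by blast
  qed
  have "norm (g z2) \<le> 1"
  proof (rule maximum_principle_off_small_values[OF v(1), where \<kappa> = "norm w1 + \<rho>" and U = U and g = g and B = "\<rho> / s"])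
    have "norm w1 < norm w0 + d" using w1(1) norm_triangle_ineq2[of w1 w0] by (simp add: dist_norm norm_minus_commute)
    then show "norm w1 + \<rho> < 1" using d by (simp add: \<rho>_def)
    show "norm (v z) \<le> norm w1 + \<rho>" if "z \<in> U" for z
      using that norm_triangle_ineq2[of "v z" w1] by (simp add: U_def dist_norm)
    show "g holomorphic_on U"
      unfolding g_def using far s(1) UC C1
      by (intro holomorphic_intros holomorphic_on_subset[OF inner_function_holomorphic[OF v(1)]]) fastforce+
    show "continuous_on (closure U \<inter> ball 0 1) g"
      unfolding g_def using far s(1) clU
      by (intro continuous_intros continuous_on_subset[OF contv]) fastforce+
    show "norm (g z) \<le> \<rho> / s" if "z \<in> U" for z
    proof -
      have "s \<le> norm (v z - w1)" using far that UC by blast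
      then show ?thesis
        unfolding g_def norm_divide using s(1) \<rho> by (auto intro!: divide_left_mono mult_pos_pos)
    qed
    show "norm (g z) \<le> 1" if z: "z \<in> frontier U \<inter> ball 0 1" for z
    proof -
      have "z \<notin> U" "z \<in> closure U" using z U by (auto simp: frontier_def interior_open)
      then have "\<rho> \<le> dist (v z) w1" using clU[of z] z by (auto simp: U_def)
      then show ?thesis using \<rho> by (simp add: g_def norm_divide dist_norm divide_le_eq_1)
    qed
    show "z2 \<in> U" using z2(1) near by (simp add: U_def)
  qed (use U UC C1 in auto)
  moreover have "1 < norm (g z2)"
  proof -
    have "0 < norm (v z2 - w1)" using far[OF z2(1)] s(1) by linarith
    then show ?thesis using near \<rho> by (simp add: g_def norm_divide dist_norm)
  qed
  ultimately show False by simp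
qed

lemma inner_preimage_connected:
  assumes v: "inner_function v" "\<And>z. norm z < 1 \<Longrightarrow> norm (v z) < 1"
    and D: "open D" "connected D" "D \<subseteq> ball 0 1" and A: "open A" "A \<subseteq> D" "A \<noteq> {}"
    and conn: "connected {z \<in> ball 0 1. v z \<in> A}"
  shows "connected {z \<in> ball 0 1. v z \<in> D}"
  unfolding connected_eq_connected_components_eq
proof (intro ballI)
  let ?P = "{z \<in> ball 0 1. v z \<in> A}"
  have sub: "?P \<subseteq> C" "?P \<inter> C \<noteq> {}" if C: "C \<in> components {z \<in> ball 0 1. v z \<in> D}" for C
  proof -
    obtain z where "z \<in> C" "v z \<in> A" using inner_component_image_meets[OF v D A C] by auto
    moreover have "C \<subseteq> ball 0 1" using in_components_subset[OF C] by auto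
    ultimately show ne: "?P \<inter> C \<noteq> {}" by blast
    show "?P \<subseteq> C"
      by (rule components_maximal[OF C conn]) (use ne A(2) in blast)+
  qed
  fix C C' assume C: "C \<in> components {z \<in> ball 0 1. v z \<in> D}" and C': "C' \<in> components {z \<in> ball 0 1. v z \<in> D}"
  have "C \<inter> C' \<noteq> {}" using sub[OF C] sub[OF C'] by blast
  then show "C = C'" using components_eq[OF C C'] by blast
qed

theorem theorem4p2:
  fixes u v :: "complex \<Rightarrow> complex"
  assumes "u \<in> one_component_inner" and "\<not> u constant_on ball 0 1"
    and "v \<in> one_component_inner" and "\<not> v constant_on ball 0 1"
  shows "u \<circ> v \<in> one_component_inner"
proof -
  have inner: "inner_function u" "inner_function v"
    using assms by (auto simp: one_component_inner_def)
  obtain \<eta> where \<eta>: "\<eta> \<in> {0<..<1}" "connected (sublevel_set u \<eta>)"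
    using assms(1,2) by (auto simp: one_component_inner_def)
  obtain \<sigma> where \<sigma>: "\<sigma> \<in> {0<..<1}" "connected (sublevel_set v \<sigma>)"
    using assms(3,4) by (auto simp: one_component_inner_def)
  have u1: "norm (u z) < 1" if "norm z < 1" for z
    using inner_function_less_one[OF inner(1) assms(2) that] .
  have v1: "norm (v z) < 1" if "norm z < 1" for z
    using inner_function_less_one[OF inner(2) assms(4) that] .
  have sub: "sublevel_set f r = {z \<in> ball 0 1. f z \<in> ball 0 r}" for f r
    by (auto simp: sublevel_set_def)
  have contu: "continuous_on (ball 0 1) u"
    using inner_function_holomorphic[OF inner(1)] by (rule holomorphic_on_imp_continuous_on)
  have "continuous_on (cball 0 \<sigma>) (\<lambda>z. norm (u z))"
    using \<sigma>(1) by (intro continuous_on_norm continuous_on_subset[OF contu]) auto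
  then obtain z0 where z0: "z0 \<in> cball 0 \<sigma>" "\<And>z. z \<in> cball 0 \<sigma> \<Longrightarrow> norm (u z) \<le> norm (u z0)"
    using continuous_attains_sup[OF compact_cball, of "0::complex" \<sigma> "\<lambda>z. norm (u z)"] \<sigma>(1) by auto
  have "norm (u z0) < 1" using z0(1) \<sigma>(1) by (intro u1) auto
  then obtain \<eta>' where \<eta>': "max \<eta> (norm (u z0)) < \<eta>'" "\<eta>' < 1"
    using dense[of "max \<eta> (norm (u z0))" 1] \<eta>(1) by auto
  define D where "D = sublevel_set u \<eta>'"
  have "connected D"
    unfolding D_def sub
    by (rule inner_preimage_connected[OF inner(1) u1 _ _ _ open_ball _ _ \<eta>(2)[unfolded sub]])
       (use \<eta>(1) \<eta>' in auto)
  moreover have "open D"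
    using continuous_open_preimage[OF contu open_ball open_ball, of 0 \<eta>'] by (simp add: D_def sub vimage_def Int_def)
  moreover have "D \<subseteq> ball 0 1" by (auto simp: D_def sublevel_set_def)
  moreover have "ball 0 \<sigma> \<subseteq> D"
  proof
    fix z :: complex assume z: "z \<in> ball 0 \<sigma>"
    then have "norm (u z) < \<eta>'" using z0(2)[of z] \<eta>'(1) by simp
    then show "z \<in> D" using z \<sigma>(1) by (simp add: D_def sublevel_set_def)
  qed
  ultimately have "connected {z \<in> ball 0 1. v z \<in> D}"
    by (intro inner_preimage_connected[OF inner(2) v1 _ _ _ open_ball _ _ \<sigma>(2)[unfolded sub]])
       (use \<sigma>(1) in auto)
  moreover have "{z \<in> ball 0 1. v z \<in> D} = sublevel_set (u \<circ> v) \<eta>'"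
    using v1 by (auto simp: D_def sublevel_set_def)
  ultimately have "connected (sublevel_set (u \<circ> v) \<eta>')" by simp
  moreover have "\<eta>' \<in> {0<..<1}" using \<eta>(1) \<eta>' by auto
  ultimately show ?thesis
    using inner_function_compose[OF inner assms(4)] by (auto simp: one_component_inner_def)
qed

end
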